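(* The syntactic category $\mathrm{Syn}(\mathsf{Glob})$, with its structure of globular category with families, is the initial globular category with families.
   Context: CwFs and their morphisms are as usual (category $\mathcal C$ with $T:\mathcal C^{op}\to\mathbf{Fam}$, chosen terminal object, context comprehension $(\Gamma,A)$, $\pi$, $p$ with the universal property; morphisms preserve terminal object and comprehension on the nose). Display maps: the smallest class containing all projections $\pi:(\Gamma,A)\to\Gamma$, closed under composition and identities. $\mathbb G$: objects $n\in\mathbb N$, generators $\sigma_i,\tau_i:i\to i+1$ with $\sigma_{i+1}\sigma_i=\tau_{i+1}\sigma_i$, $\sigma_{i+1}\tau_i=\tau_{i+1}\tau_i$. A globular CwF is a CwF $\mathcal C$ with a functor $F:\mathbb G^{op}\to\mathcal C$ sending all morphisms to display maps; write $D^n=F(n)$, $s=F\sigma$, $t=F\tau$. Spheres: $S^{-1}_F$ the terminal object with $\mathrm{ty}:D^0\to S^{-1}_F$ unique; $S^n_F$ the pullback of $D^n\xrightarrow{\mathrm{ty}}S^{n-1}_F\xleftarrow{\mathrm{ty}}D^n$; $\mathrm{ty}:D^{n+1}\to S^n_F$ induced by $(s,t)$. One also requires a natural transformation $\mathrm{ty}:\coprod_{n\in\mathbb N}\mathcal C(\Gamma,S^{n-1}_F)\to\mathrm{Ty}^\Gamma$ such that $(S^{n-1}_F,\mathrm{ty}(\mathrm{id}_{S^{n-1}_F}))\cong D^n$ compatibly with $\pi$ and $\mathrm{ty}:D^n\to S^{n-1}_F$. A morphism of globular CwFs $(\mathcal C,F)\to(\mathcal D,G)$ is a CwF morphism $(f,\phi)$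 with a unique natural isomorphism $f\circ F\cong G$ such that $\phi(\mathrm{ty}(\sigma))=\mathrm{ty}(f\sigma)$ under the induced isomorphisms $f(S^{n-1}_F)\cong S^{n-1}_G$. $\mathsf{Glob}$ is the type theory with only variables, types $\star$ and $t\to_Au$, standard rules; $\mathrm{Syn}(\mathsf{Glob})$ its syntactic CwF. Its globular structure sends $n$ to the disk context $D^n$, where $S^{-1}=()$, $D^n=(S^{n-1},d_{2n}:U_n)$, $S^n=(D^n,d_{2n+1}:U_n)$, $U_0=\star$, $U_{n+1}=d_{2n}\to_{U_n}d_{2n+1}$, the maps $D^{n+1}\to D^n$ being the substitutions sending $d_{2n}$ to $d_{2n}$ (source) resp. $d_{2n+1}$ (target) and fixing $d_0,\dots,d_{2n-1}$; and $\mathrm{ty}(\sigma)=U_n[\sigma]$ for $\sigma:\Gamma\to S^{n-1}$.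
   Formalization: Display maps are also closed under isomorphism of maps (else the target maps of Syn(Glob) are not display), and the isos (S^{n-1}, ty(id)) ≅ D^n are chosen structure with which the natural isomorphism f∘F ≅ G of a morphism must be compatible (else uniqueness fails). *)

theory Defs
  imports Main "HOL-Library.FuncSet"
begin

section \<open>Categories and functors\<close>

record ('o, 'm) cat =
  Obj :: "'o set"
  Arr :: "'m set"
  Dom :: "'m \<Rightarrow> 'o"
  Cod :: "'m \<Rightarrow> 'o"
  Ide :: "'o \<Rightarrow> 'm"
  Comp :: "'m \<Rightarrow> 'm \<Rightarrow> 'm"  (infixr \<open>\<cdot>\<index>\<close> 70)

definition hom :: "('o, 'm, 'z) cat_scheme \<Rightarrow> 'o \<Rightarrow> 'o \<Rightarrow> 'm set" where
  "hom C a b = {f \<in> Arr C. Dom C f = a \<and> Cod C f = b}"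

locale category =
  fixes C :: "('o, 'm, 'z) cat_scheme" (structure)
  assumes Dom_in: "f \<in> Arr C \<Longrightarrow> Dom C f \<in> Obj C"
    and Cod_in: "f \<in> Arr C \<Longrightarrow> Cod C f \<in> Obj C"
    and Ide_in: "a \<in> Obj C \<Longrightarrow> Ide C a \<in> hom C a a"
    and Comp_in: "\<lbrakk>f \<in> hom C a b; g \<in> hom C b c\<rbrakk> \<Longrightarrow> g \<cdot> f \<in> hom C a c"
    and Comp_Ide: "f \<in> hom C a b \<Longrightarrow> f \<cdot> Ide C a = f"
    and Ide_Comp: "f \<in> hom C a b \<Longrightarrow> Ide C b \<cdot> f = f"
    and Comp_assoc: "\<lbrakk>f \<in> hom C a b; g \<in> hom C b c; h \<in> hom C c d\<rbrakk>
          \<Longrightarrow> (h \<cdot> g) \<cdot> f = h \<cdot> (g \<cdot> f)"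

definition opposite :: "('o, 'm, 'z) cat_scheme \<Rightarrow> ('o, 'm) cat" where
  "opposite C = \<lparr>Obj = Obj C, Arr = Arr C, Dom = Cod C, Cod = Dom C, Ide = Ide C,
     Comp = (\<lambda>g f. Comp C f g)\<rparr>"

definition is_iso :: "('o, 'm, 'z) cat_scheme \<Rightarrow> 'm \<Rightarrow> bool" where
  "is_iso C f \<longleftrightarrow> f \<in> Arr C \<and>
     (\<exists>g \<in> hom C (Cod C f) (Dom C f).
        Comp C g f = Ide C (Dom C f) \<and> Comp C f g = Ide C (Cod C f))"

definition is_pullback ::
  "('o, 'm, 'z) cat_scheme \<Rightarrow> 'm \<Rightarrow> 'm \<Rightarrow> 'o \<Rightarrow> 'm \<Rightarrow> 'm \<Rightarrow> bool" where
  "is_pullback C f g P p q \<longleftrightarrow>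
     f \<in> Arr C \<and> g \<in> Arr C \<and> Cod C f = Cod C g \<and>
     p \<in> hom C P (Dom C f) \<and> q \<in> hom C P (Dom C g) \<and> Comp C f p = Comp C g q \<and>
     (\<forall>X \<in> Obj C. \<forall>x \<in> hom C X (Dom C f). \<forall>y \<in> hom C X (Dom C g).
        Comp C f x = Comp C g y \<longrightarrow>
        (\<exists>!u. u \<in> hom C X P \<and> Comp C p u = x \<and> Comp C q u = y))"

record ('o1, 'm1, 'o2, 'm2) ftor =
  fob :: "'o1 \<Rightarrow> 'o2"
  farr :: "'m1 \<Rightarrow> 'm2"

definition is_functor ::
  "('o1, 'm1, 'y) cat_scheme \<Rightarrow> ('o2, 'm2, 'z) cat_scheme \<Rightarrow>
   ('o1, 'm1, 'o2, 'm2, 'w) ftor_scheme \<Rightarrow> bool" where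
  "is_functor A B F \<longleftrightarrow>
     (\<forall>a \<in> Obj A. fob F a \<in> Obj B) \<and>
     (\<forall>f \<in> Arr A. farr F f \<in> hom B (fob F (Dom A f)) (fob F (Cod A f))) \<and>
     (\<forall>a \<in> Obj A. farr F (Ide A a) = Ide B (fob F a)) \<and>
     (\<forall>f \<in> Arr A. \<forall>g \<in> Arr A. Cod A f = Dom A g \<longrightarrow>
        farr F (Comp A g f) = Comp B (farr F g) (farr F f))"

definition ftor_comp ::
  "('o2, 'm2, 'o3, 'm3, 'y) ftor_scheme \<Rightarrow> ('o1, 'm1, 'o2, 'm2, 'z) ftor_scheme \<Rightarrow>
   ('o1, 'm1, 'o3, 'm3) ftor" where
  "ftor_comp G F = \<lparr>fob = fob G \<circ> fob F, farr = farr G \<circ> farr F\<rparr>"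

definition natural_iso ::
  "('o1, 'm1, 'y) cat_scheme \<Rightarrow> ('o2, 'm2, 'z) cat_scheme \<Rightarrow>
   ('o1, 'm1, 'o2, 'm2, 'v) ftor_scheme \<Rightarrow> ('o1, 'm1, 'o2, 'm2, 'w) ftor_scheme \<Rightarrow>
   ('o1 \<Rightarrow> 'm2) \<Rightarrow> bool" where
  "natural_iso A B F G \<alpha> \<longleftrightarrow>
     (\<forall>a \<in> Obj A. \<alpha> a \<in> hom B (fob F a) (fob G a) \<and> is_iso B (\<alpha> a)) \<and>
     (\<forall>f \<in> Arr A. Comp B (farr G f) (\<alpha> (Dom A f)) = Comp B (\<alpha> (Cod A f)) (farr F f))"


section \<open>Categories with families\<close>

text \<open>The functor to families of sets is unfolded: \<open>Ty C \<Gamma>\<close> is the index set of the family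
  at \<open>\<Gamma>\<close> and \<open>Tm C \<Gamma> A\<close> its fibre over \<open>A\<close>. Fibres over different types may overlap, so
  the action on terms \<open>tmsub C \<sigma> A\<close> also takes the type.\<close>

record ('o, 'm, 't, 'e) cwf = "('o, 'm) cat" +
  Ty :: "'o \<Rightarrow> 't set"
  Tm :: "'o \<Rightarrow> 't \<Rightarrow> 'e set"
  tysub :: "'m \<Rightarrow> 't \<Rightarrow> 't"
  tmsub :: "'m \<Rightarrow> 't \<Rightarrow> 'e \<Rightarrow> 'e"
  One :: "'o"
  Ext :: "'o \<Rightarrow> 't \<Rightarrow> 'o"
  Proj :: "'o \<Rightarrow> 't \<Rightarrow> 'm"
  Gen :: "'o \<Rightarrow> 't \<Rightarrow> 'e"

locale cwf = category C
  for C :: "('o, 'm, 't, 'e, 'z) cwf_scheme" (structure) +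
  assumes tysub_in: "\<lbrakk>\<sigma> \<in> hom C \<Delta> \<Gamma>; A \<in> Ty C \<Gamma>\<rbrakk> \<Longrightarrow> tysub C \<sigma> A \<in> Ty C \<Delta>"
    and tmsub_in: "\<lbrakk>\<sigma> \<in> hom C \<Delta> \<Gamma>; A \<in> Ty C \<Gamma>; a \<in> Tm C \<Gamma> A\<rbrakk>
          \<Longrightarrow> tmsub C \<sigma> A a \<in> Tm C \<Delta> (tysub C \<sigma> A)"
    and tysub_Ide: "\<lbrakk>\<Gamma> \<in> Obj C; A \<in> Ty C \<Gamma>\<rbrakk> \<Longrightarrow> tysub C (Ide C \<Gamma>) A = A"
    and tmsub_Ide: "\<lbrakk>\<Gamma> \<in> Obj C; A \<in> Ty C \<Gamma>; a \<in> Tm C \<Gamma> A\<rbrakk> \<Longrightarrow> tmsub C (Ide C \<Gamma>) A a = a"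
    and tysub_Comp: "\<lbrakk>\<tau> \<in> hom C \<Theta> \<Delta>; \<sigma> \<in> hom C \<Delta> \<Gamma>; A \<in> Ty C \<Gamma>\<rbrakk>
          \<Longrightarrow> tysub C (\<sigma> \<cdot> \<tau>) A = tysub C \<tau> (tysub C \<sigma> A)"
    and tmsub_Comp: "\<lbrakk>\<tau> \<in> hom C \<Theta> \<Delta>; \<sigma> \<in> hom C \<Delta> \<Gamma>; A \<in> Ty C \<Gamma>; a \<in> Tm C \<Gamma> A\<rbrakk>
          \<Longrightarrow> tmsub C (\<sigma> \<cdot> \<tau>) A a = tmsub C \<tau> (tysub C \<sigma> A) (tmsub C \<sigma> A a)"
    and One_in: "One C \<in> Obj C"
    and One_terminal: "\<Gamma> \<in> Obj C \<Longrightarrow> \<exists>!u. u \<in> hom C \<Gamma> (One C)"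
    and Ext_in: "\<lbrakk>\<Gamma> \<in> Obj C; A \<in> Ty C \<Gamma>\<rbrakk> \<Longrightarrow> Ext C \<Gamma> A \<in> Obj C"
    and Proj_in: "\<lbrakk>\<Gamma> \<in> Obj C; A \<in> Ty C \<Gamma>\<rbrakk> \<Longrightarrow> Proj C \<Gamma> A \<in> hom C (Ext C \<Gamma> A) \<Gamma>"
    and Gen_in: "\<lbrakk>\<Gamma> \<in> Obj C; A \<in> Ty C \<Gamma>\<rbrakk>
          \<Longrightarrow> Gen C \<Gamma> A \<in> Tm C (Ext C \<Gamma> A) (tysub C (Proj C \<Gamma> A) A)"
    and Ext_universal:
      "\<lbrakk>\<Gamma> \<in> Obj C; A \<in> Ty C \<Gamma>; \<sigma> \<in> hom C \<Delta> \<Gamma>; a \<in> Tm C \<Delta> (tysub C \<sigma> A)\<rbrakk>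
          \<Longrightarrow> \<exists>!u. u \<in> hom C \<Delta> (Ext C \<Gamma> A) \<and> Proj C \<Gamma> A \<cdot> u = \<sigma> \<and>
                   tmsub C u (tysub C (Proj C \<Gamma> A) A) (Gen C \<Gamma> A) = a"

definition ext_map ::
  "('o, 'm, 't, 'e, 'z) cwf_scheme \<Rightarrow> 'o \<Rightarrow> 't \<Rightarrow> 'm \<Rightarrow> 'e \<Rightarrow> 'm" where
  "ext_map C \<Gamma> A \<sigma> a =
     (THE u. u \<in> hom C (Dom C \<sigma>) (Ext C \<Gamma> A) \<and> Comp C (Proj C \<Gamma> A) u = \<sigma> \<and>
             tmsub C u (tysub C (Proj C \<Gamma> A) A) (Gen C \<Gamma> A) = a)"

text \<open>The class of display maps is taken to be closed under isomorphism of maps (rule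
  \<open>iso\<close>). This is needed in the syntactic category below: the target map from the
  1-disk to the 0-disk, which sends \<open>d\<^sub>0\<close> to \<open>d\<^sub>1\<close>, is isomorphic to a composite of
  projections but is not itself such a composite.\<close>

inductive display :: "('o, 'm, 't, 'e, 'z) cwf_scheme \<Rightarrow> 'm \<Rightarrow> bool"
  for C :: "('o, 'm, 't, 'e, 'z) cwf_scheme" where
  proj: "\<lbrakk>\<Gamma> \<in> Obj C; A \<in> Ty C \<Gamma>\<rbrakk> \<Longrightarrow> display C (Proj C \<Gamma> A)"
| ident: "\<Gamma> \<in> Obj C \<Longrightarrow> display C (Ide C \<Gamma>)"
| comp: "\<lbrakk>display C f; display C g; Cod C f = Dom C g\<rbrakk> \<Longrightarrow> display C (Comp C g f)"
| iso: "\<lbrakk>display C f; is_iso C i; is_iso C j; Cod C i = Dom C f; Cod C f = Dom C j\<rbrakk>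
          \<Longrightarrow> display C (Comp C j (Comp C f i))"

record ('o1, 'm1, 't1, 'e1, 'o2, 'm2, 't2, 'e2) cwf_mor = "('o1, 'm1, 'o2, 'm2) ftor" +
  fty :: "'o1 \<Rightarrow> 't1 \<Rightarrow> 't2"
  ftm :: "'o1 \<Rightarrow> 't1 \<Rightarrow> 'e1 \<Rightarrow> 'e2"

text \<open>The extensionality conditions force the components to be \<open>undefined\<close> outside the
  carriers, so that equality of records is equality of morphisms.\<close>

definition cwf_morphism ::
  "('o1, 'm1, 't1, 'e1, 'y) cwf_scheme \<Rightarrow> ('o2, 'm2, 't2, 'e2, 'z) cwf_scheme \<Rightarrow>
   ('o1, 'm1, 't1, 'e1, 'o2, 'm2, 't2, 'e2) cwf_mor \<Rightarrow> bool" where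
  "cwf_morphism C D h \<longleftrightarrow>
     is_functor C D h \<and>
     (\<forall>\<Gamma> \<in> Obj C. \<forall>A \<in> Ty C \<Gamma>. fty h \<Gamma> A \<in> Ty D (fob h \<Gamma>)) \<and>
     (\<forall>\<Gamma> \<in> Obj C. \<forall>A \<in> Ty C \<Gamma>. \<forall>a \<in> Tm C \<Gamma> A.
        ftm h \<Gamma> A a \<in> Tm D (fob h \<Gamma>) (fty h \<Gamma> A)) \<and>
     (\<forall>\<Delta> \<in> Obj C. \<forall>\<Gamma> \<in> Obj C. \<forall>\<sigma> \<in> hom C \<Delta> \<Gamma>. \<forall>A \<in> Ty C \<Gamma>.
        fty h \<Delta> (tysub C \<sigma> A) = tysub D (farr h \<sigma>) (fty h \<Gamma> A)) \<and>
     (\<forall>\<Delta> \<in> Obj C. \<forall>\<Gamma> \<in> Obj C. \<forall>\<sigma> \<in> hom C \<Delta> \<Gamma>. \<forall>A \<in> Ty C \<Gamma>. \<forall>a \<in> Tm C \<Gamma> A.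
        ftm h \<Delta> (tysub C \<sigma> A) (tmsub C \<sigma> A a) =
        tmsub D (farr h \<sigma>) (fty h \<Gamma> A) (ftm h \<Gamma> A a)) \<and>
     fob h (One C) = One D \<and>
     (\<forall>\<Gamma> \<in> Obj C. \<forall>A \<in> Ty C \<Gamma>.
        fob h (Ext C \<Gamma> A) = Ext D (fob h \<Gamma>) (fty h \<Gamma> A) \<and>
        farr h (Proj C \<Gamma> A) = Proj D (fob h \<Gamma>) (fty h \<Gamma> A) \<and>
        ftm h (Ext C \<Gamma> A) (tysub C (Proj C \<Gamma> A) A) (Gen C \<Gamma> A) =
          Gen D (fob h \<Gamma>) (fty h \<Gamma> A)) \<and>
     fob h \<in> extensional (Obj C) \<and>
     farr h \<in> extensional (Arr C) \<and>
     (\<forall>\<Gamma> A. \<not> (\<Gamma> \<in> Obj C \<and> A \<in> Ty C \<Gamma>) \<longrightarrow> fty h \<Gamma> A = undefined) \<and>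
     (\<forall>\<Gamma> A a. \<not> (\<Gamma> \<in> Obj C \<and> A \<in> Ty C \<Gamma> \<and> a \<in> Tm C \<Gamma> A) \<longrightarrow> ftm h \<Gamma> A a = undefined)"


section \<open>The category of globes\<close>

text \<open>A path starting at \<open>i\<close> is a list of generators, the one applied first at the head; its
  \<open>k\<close>-th entry stands for \<open>\<sigma>\<close> or \<open>\<tau>\<close> with index \<open>i + k\<close>. Since the relations have the same
  shape at every index, the congruence they generate is defined on lists.\<close>

datatype glob_gen = Sigma_gen | Tau_gen

inductive glob_rel :: "glob_gen list \<Rightarrow> glob_gen list \<Rightarrow> bool" where
  base: "glob_rel (u @ [g, Sigma_gen] @ v) (u @ [g, Tau_gen] @ v)"
| refl: "glob_rel u u"
| sym: "glob_rel u v \<Longrightarrow> glob_rel v u"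
| trans: "\<lbrakk>glob_rel u v; glob_rel v w\<rbrakk> \<Longrightarrow> glob_rel u w"

lemma equivp_glob_rel: "equivp glob_rel"
  by (rule equivpI) (auto simp: reflp_def symp_def transp_def intro: glob_rel.intros)

quotient_type glob_path = "glob_gen list" / glob_rel
  by (rule equivp_glob_rel)

lemma glob_rel_length: "glob_rel u v \<Longrightarrow> length u = length v"
  by (induction rule: glob_rel.induct) auto

lemma glob_rel_append_left: "glob_rel u v \<Longrightarrow> glob_rel (w @ u) (w @ v)"
proof (induction rule: glob_rel.induct)
  case (base u g v)
  show ?case using glob_rel.base[of "w @ u" g v] by simp
qed (blast intro: glob_rel.intros)+

lemma glob_rel_append_right: "glob_rel u v \<Longrightarrow> glob_rel (u @ w) (v @ w)"
proof (induction rule: glob_rel.induct)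
  case (base u g v)
  show ?case using glob_rel.base[of u g "v @ w"] by simp
qed (blast intro: glob_rel.intros)+

lift_definition path_nil :: "glob_path" is "[]" .

lift_definition path_gen :: "glob_gen \<Rightarrow> glob_path" is "\<lambda>g. [g]" .

lift_definition path_length :: "glob_path \<Rightarrow> nat" is length
  by (rule glob_rel_length)

lift_definition path_append :: "glob_path \<Rightarrow> glob_path \<Rightarrow> glob_path" is append
  by (blast intro: glob_rel.trans glob_rel_append_left glob_rel_append_right)

type_synonym glob_arr = "nat \<times> glob_path"

definition Globe :: "(nat, glob_arr) cat" where
  "Globe = \<lparr>Obj = UNIV, Arr = UNIV, Dom = fst, Cod = (\<lambda>(i, p). i + path_length p),
     Ide = (\<lambda>i. (i, path_nil)),
     Comp = (\<lambda>(j, q) (i, p). (i, path_append p q))\<rparr>"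

definition glob_sigma :: "nat \<Rightarrow> glob_arr" where
  "glob_sigma i = (i, path_gen Sigma_gen)"

definition glob_tau :: "nat \<Rightarrow> glob_arr" where
  "glob_tau i = (i, path_gen Tau_gen)"


section \<open>Globular categories with families\<close>

text \<open>Spheres are indexed from zero: \<open>Sph C n\<close> is the sphere of dimension \<open>n - 1\<close>. The
  spheres come with a choice of pullbacks (\<open>SphL\<close>, \<open>SphR\<close> are the two projections), and
  \<open>DiskIso\<close> is the chosen isomorphism from \<open>(S\<^sup>n\<^sup>-\<^sup>1, ty(id))\<close> to \<open>D\<^sup>n\<close>; neither
  choice is preserved on the nose by morphisms. \<open>GTy C n\<close> is the component of the
  transformation \<open>ty\<close> on the \<open>n\<close>-th summand of the coproduct.\<close>

record ('o, 'm, 't, 'e) gcwf = "('o, 'm, 't, 'e) cwf" +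
  Disk :: "(nat, glob_arr, 'o, 'm) ftor"
  Sph :: "nat \<Rightarrow> 'o"
  SphL :: "nat \<Rightarrow> 'm"
  SphR :: "nat \<Rightarrow> 'm"
  GTy :: "nat \<Rightarrow> 'm \<Rightarrow> 't"
  DiskIso :: "nat \<Rightarrow> 'm"

primrec tymap :: "('o, 'm, 't, 'e, 'z) gcwf_scheme \<Rightarrow> nat \<Rightarrow> 'm" where
  "tymap C 0 = (THE u. u \<in> hom C (fob (Disk C) 0) (Sph C 0))"
| "tymap C (Suc n) =
     (THE u. u \<in> hom C (fob (Disk C) (Suc n)) (Sph C (Suc n)) \<and>
             Comp C (SphL C n) u = farr (Disk C) (glob_sigma n) \<and>
             Comp C (SphR C n) u = farr (Disk C) (glob_tau n))"

locale globular_cwf = cwf C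
  for C :: "('o, 'm, 't, 'e, 'z) gcwf_scheme" (structure) +
  assumes Disk_functor: "is_functor (opposite Globe) C (Disk C)"
    and Disk_display: "f \<in> Arr (opposite Globe) \<Longrightarrow> display C (farr (Disk C) f)"
    and Sph_0: "Sph C 0 = One C"
    and Sph_Suc: "is_pullback C (tymap C n) (tymap C n) (Sph C (Suc n)) (SphL C n) (SphR C n)"
    and GTy_in: "\<sigma> \<in> hom C \<Gamma> (Sph C n) \<Longrightarrow> GTy C n \<sigma> \<in> Ty C \<Gamma>"
    and GTy_natural: "\<lbrakk>\<tau> \<in> hom C \<Delta> \<Gamma>; \<sigma> \<in> hom C \<Gamma> (Sph C n)\<rbrakk>
          \<Longrightarrow> GTy C n (\<sigma> \<cdot> \<tau>) = tysub C \<tau> (GTy C n \<sigma>)"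
    and DiskIso_in: "DiskIso C n \<in>
          hom C (Ext C (Sph C n) (GTy C n (Ide C (Sph C n)))) (fob (Disk C) n)"
    and DiskIso_iso: "is_iso C (DiskIso C n)"
    and DiskIso_over: "tymap C n \<cdot> DiskIso C n = Proj C (Sph C n) (GTy C n (Ide C (Sph C n)))"

text \<open>The comparison map from \<open>h(Sph C n)\<close> to \<open>Sph D n\<close> induced by \<open>\<alpha> : h \<circ> Disk C \<cong> Disk D\<close>.\<close>

primrec sph_map ::
  "('o1, 'm1, 't1, 'e1, 'y) gcwf_scheme \<Rightarrow> ('o2, 'm2, 't2, 'e2, 'z) gcwf_scheme \<Rightarrow>
   ('o1, 'm1, 't1, 'e1, 'o2, 'm2, 't2, 'e2) cwf_mor \<Rightarrow> (nat \<Rightarrow> 'm2) \<Rightarrow> nat \<Rightarrow> 'm2" where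
  "sph_map C D h \<alpha> 0 = (THE u. u \<in> hom D (fob h (Sph C 0)) (Sph D 0))"
| "sph_map C D h \<alpha> (Suc n) =
     (THE u. u \<in> hom D (fob h (Sph C (Suc n))) (Sph D (Suc n)) \<and>
             Comp D (SphL D n) u = Comp D (\<alpha> n) (farr h (SphL C n)) \<and>
             Comp D (SphR D n) u = Comp D (\<alpha> n) (farr h (SphR C n)))"

text \<open>The natural isomorphism \<open>\<alpha>\<close> is the one induced by the structure: besides
  \<open>\<phi>(ty(\<sigma>)) = ty(f\<sigma>)\<close> it is required to identify, through \<open>DiskIso\<close>, the comprehensions
  \<open>f(S\<^sup>n\<^sup>-\<^sup>1, ty(id)) = (f S\<^sup>n\<^sup>-\<^sup>1, \<phi>(ty(id)))\<close> and \<open>(S\<^sup>n\<^sup>-\<^sup>1, ty(id))\<close>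
  along the map that the sphere comparison induces between them. Without this
  last condition \<open>\<alpha>\<close> could be changed by any automorphism of the functor \<open>Disk D\<close> that
  leaves \<open>ty\<close> invariant.\<close>

definition globular_morphism ::
  "('o1, 'm1, 't1, 'e1, 'y) gcwf_scheme \<Rightarrow> ('o2, 'm2, 't2, 'e2, 'z) gcwf_scheme \<Rightarrow>
   ('o1, 'm1, 't1, 'e1, 'o2, 'm2, 't2, 'e2) cwf_mor \<Rightarrow> bool" where
  "globular_morphism C D h \<longleftrightarrow>
     cwf_morphism C D h \<and>
     (\<exists>!\<alpha>. natural_iso (opposite Globe) D (ftor_comp h (Disk C)) (Disk D) \<alpha> \<and>
        (\<forall>n. \<forall>\<Gamma> \<in> Obj C. \<forall>\<sigma> \<in> hom C \<Gamma> (Sph C n).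
           fty h \<Gamma> (GTy C n \<sigma>) = GTy D n (Comp D (sph_map C D h \<alpha> n) (farr h \<sigma>))) \<and>
        (\<forall>n. let B = fty h (Sph C n) (GTy C n (Ide C (Sph C n))) in
           Comp D (\<alpha> n) (farr h (DiskIso C n)) =
           Comp D (DiskIso D n)
             (ext_map D (Sph D n) (GTy D n (Ide D (Sph D n)))
                (Comp D (sph_map C D h \<alpha> n) (Proj D (fob h (Sph C n)) B))
                (Gen D (fob h (Sph C n)) B))))"


section \<open>The type theory Glob and its syntactic category with families\<close>

text \<open>Variables are de Bruijn levels: \<open>Var i\<close> is the variable \<open>d\<^sub>i\<close> declared at
  position \<open>i\<close> of the context, so weakening does not change raw types and terms.
  \<open>Arrow A t u\<close> is the type of arrows from \<open>t\<close> to \<open>u\<close> over \<open>A\<close>.\<close>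

datatype gtm = Var nat

datatype gty = Star | Arrow gty gtm gtm

type_synonym gctx = "gty list"

type_synonym gsub = "gtm list"

primrec subst_tm :: "gsub \<Rightarrow> gtm \<Rightarrow> gtm" where
  "subst_tm \<gamma> (Var i) = \<gamma> ! i"

primrec subst_ty :: "gsub \<Rightarrow> gty \<Rightarrow> gty" where
  "subst_ty \<gamma> Star = Star"
| "subst_ty \<gamma> (Arrow A t u) = Arrow (subst_ty \<gamma> A) (subst_tm \<gamma> t) (subst_tm \<gamma> u)"

definition subst_id :: "nat \<Rightarrow> gsub" where
  "subst_id k = map Var [0..<k]"

definition subst_comp :: "gsub \<Rightarrow> gsub \<Rightarrow> gsub" where
  "subst_comp \<gamma> \<delta> = map (subst_tm \<delta>) \<gamma>"

inductive wf_ctx :: "gctx \<Rightarrow> bool"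
  and wf_ty :: "gctx \<Rightarrow> gty \<Rightarrow> bool"
  and wf_tm :: "gctx \<Rightarrow> gtm \<Rightarrow> gty \<Rightarrow> bool" where
  ctx_empty: "wf_ctx []"
| ctx_ext: "\<lbrakk>wf_ctx \<Gamma>; wf_ty \<Gamma> A\<rbrakk> \<Longrightarrow> wf_ctx (\<Gamma> @ [A])"
| ty_star: "wf_ctx \<Gamma> \<Longrightarrow> wf_ty \<Gamma> Star"
| ty_arrow: "\<lbrakk>wf_ty \<Gamma> A; wf_tm \<Gamma> t A; wf_tm \<Gamma> u A\<rbrakk> \<Longrightarrow> wf_ty \<Gamma> (Arrow A t u)"
| tm_var: "\<lbrakk>wf_ctx \<Gamma>; i < length \<Gamma>\<rbrakk> \<Longrightarrow> wf_tm \<Gamma> (Var i) (\<Gamma> ! i)"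

inductive wf_sub :: "gctx \<Rightarrow> gsub \<Rightarrow> gctx \<Rightarrow> bool" where
  sub_empty: "wf_ctx \<Delta> \<Longrightarrow> wf_sub \<Delta> [] []"
| sub_ext: "\<lbrakk>wf_sub \<Delta> \<gamma> \<Gamma>; wf_ctx (\<Gamma> @ [A]); wf_tm \<Delta> t (subst_ty \<gamma> A)\<rbrakk>
      \<Longrightarrow> wf_sub \<Delta> (\<gamma> @ [t]) (\<Gamma> @ [A])"

text \<open>\<open>U_ty n\<close> is \<open>U\<^sub>n\<close>, \<open>disk_ctx n\<close> is \<open>D\<^sup>n\<close>, and \<open>sph_ctx n\<close> is the sphere of
  dimension \<open>n - 1\<close>.\<close>

primrec U_ty :: "nat \<Rightarrow> gty" where
  "U_ty 0 = Star"
| "U_ty (Suc n) = Arrow (U_ty n) (Var (2 * n)) (Var (2 * n + 1))"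

primrec sph_ctx :: "nat \<Rightarrow> gctx" where
  "sph_ctx 0 = []"
| "sph_ctx (Suc n) = (sph_ctx n @ [U_ty n]) @ [U_ty n]"

definition disk_ctx :: "nat \<Rightarrow> gctx" where
  "disk_ctx n = sph_ctx n @ [U_ty n]"

primrec gen_sub :: "nat \<Rightarrow> glob_gen \<Rightarrow> gsub" where
  "gen_sub n Sigma_gen = subst_id (2 * n) @ [Var (2 * n)]"
| "gen_sub n Tau_gen = subst_id (2 * n) @ [Var (2 * n + 1)]"

primrec word_sub :: "nat \<Rightarrow> glob_gen list \<Rightarrow> gsub" where
  "word_sub n [] = subst_id (2 * n + 1)"
| "word_sub n (g # w) = subst_comp (gen_sub n g) (word_sub (Suc n) w)"

lemma length_word_sub: "length (word_sub n w) = 2 * n + 1"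
  by (cases w; cases "hd w") (auto simp: subst_id_def subst_comp_def)

lemma word_sub_base:
  "word_sub n (u @ [g, Sigma_gen] @ v) = word_sub n (u @ [g, Tau_gen] @ v)"
proof (induction u arbitrary: n)
  case Nil
  show ?case
    by (cases g)
      (auto simp: subst_comp_def subst_id_def nth_append length_word_sub)
qed auto

lift_definition path_sub :: "nat \<Rightarrow> glob_path \<Rightarrow> gsub" is word_sub
proof -
  fix n u v
  assume "glob_rel u v"
  then show "word_sub n u = word_sub n v"
    by (induction rule: glob_rel.induct) (metis word_sub_base | simp)+
qed

type_synonym gmor = "gctx \<times> gsub \<times> gctx"

text \<open>A morphism \<open>(\<Delta>, \<gamma>, \<Gamma>)\<close> is a substitution from \<open>\<Delta>\<close> to \<open>\<Gamma>\<close>.\<close>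

definition Syn_Glob :: "(gctx, gmor, gty, gtm) gcwf" where
  "Syn_Glob =
    \<lparr>Obj = {\<Gamma>. wf_ctx \<Gamma>},
     Arr = {(\<Delta>, \<gamma>, \<Gamma>). wf_sub \<Delta> \<gamma> \<Gamma>},
     Dom = (\<lambda>(\<Delta>, \<gamma>, \<Gamma>). \<Delta>),
     Cod = (\<lambda>(\<Delta>, \<gamma>, \<Gamma>). \<Gamma>),
     Ide = (\<lambda>\<Gamma>. (\<Gamma>, subst_id (length \<Gamma>), \<Gamma>)),
     Comp = (\<lambda>(\<Delta>, \<gamma>, \<Gamma>) (\<Theta>, \<delta>, \<Delta>'). (\<Theta>, subst_comp \<gamma> \<delta>, \<Gamma>)),
     Ty = (\<lambda>\<Gamma>. {A. wf_ty \<Gamma> A}),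
     Tm = (\<lambda>\<Gamma> A. {t. wf_tm \<Gamma> t A}),
     tysub = (\<lambda>(\<Delta>, \<gamma>, \<Gamma>) A. subst_ty \<gamma> A),
     tmsub = (\<lambda>(\<Delta>, \<gamma>, \<Gamma>) A t. subst_tm \<gamma> t),
     One = [],
     Ext = (\<lambda>\<Gamma> A. \<Gamma> @ [A]),
     Proj = (\<lambda>\<Gamma> A. (\<Gamma> @ [A], subst_id (length \<Gamma>), \<Gamma>)),
     Gen = (\<lambda>\<Gamma> A. Var (length \<Gamma>)),
     Disk = \<lparr>fob = disk_ctx,
             farr = (\<lambda>(n, p). (disk_ctx (n + path_length p), path_sub n p, disk_ctx n))\<rparr>,
     Sph = sph_ctx,
     SphL = (\<lambda>n. (sph_ctx (Suc n), subst_id (2 * n) @ [Var (2 * n)], disk_ctx n)),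
     SphR = (\<lambda>n. (sph_ctx (Suc n), subst_id (2 * n) @ [Var (2 * n + 1)], disk_ctx n)),
     GTy = (\<lambda>n (\<Delta>, \<gamma>, \<Gamma>). subst_ty \<gamma> (U_ty n)),
     DiskIso = (\<lambda>n. (disk_ctx n, subst_id (2 * n + 1), disk_ctx n))\<rparr>"

end

theory Submission
  imports Defs
begin

text \<open>
  A type \<open>A\<close> of dimension \<open>n\<close> in a context \<open>\<Gamma>\<close> of \<open>Glob\<close> is \<open>U\<^sub>n\<close> substituted along a unique
  map from \<open>\<Gamma>\<close> to the \<open>(n-1)\<close>-sphere, and in any globular category with families \<open>C\<close> the terms
  of type \<open>ty(s)\<close> in \<open>X\<close> are the lifts of \<open>s : X \<rightarrow> S\<^sup>n\<^sup>-\<^sup>1\<close> along \<open>ty : D\<^sup>n \<rightarrow> S\<^sup>n\<^sup>-\<^sup>1\<close>. Hence a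
  context is interpreted in \<open>C\<close> by an object representing the families of maps into disks, one
  for each variable, whose boundaries are prescribed by the types of the variables.
  Substitutions are interpreted through this universal property, so functoriality and
  compatibility with comprehension follow from uniqueness. On the disk contexts the last
  variable is the comparison map to \<open>D\<^sup>n\<close>; it is invertible because a map into a disk
  determines its iterated boundary. Conversely, any globular morphism must send
  \<open>U\<^sub>n[\<sigma>]\<close> to \<open>ty(f\<sigma>)\<close> and the last variable to the generic term, which by induction on
  contexts leaves no choice.
\<close>

section \<open>The syntactic category with families\<close>

text \<open>The obstacle is a mixture of strict and weak requirements. A morphism sends
  \<open>Ext\<close>, \<open>Proj\<close> and \<open>Gen\<close> to their counterparts on the nose,
  while disks and spheres are preserved only up to \<open>\<alpha>\<close>, and the target's
  pullbacks and \<open>DiskIso\<close> are arbitrary choices. Contexts are therefore interpreted by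
  comprehensions of \<open>C\<close> alone, and the disks enter only as codomains of the maps
  recorded for the variables, with \<open>DiskIso\<close> translating between such maps and terms.
  Interpreting a dependent theory usually needs a mutual recursion over contexts, types and terms.
  Here every term is a variable, so the family of maps attached to the variables carries all the
  information, and \<open>sph_of\<close> is not even recursive: the endpoints of an arrow type
  already carry the boundary prescribed by its base type. Uniqueness of \<open>\<alpha>\<close> is a
  ladder. The condition on \<open>DiskIso\<close> determines \<open>\<alpha> n\<close> from the
  sphere comparison at \<open>n\<close>, and the sphere comparison at \<open>Suc n\<close> is
  induced by \<open>\<alpha> n\<close>. Types climb a similar ladder: the image of an arrow type
  depends only on the images of its base type and of its endpoints.\<close>

inductive_cases wf_ctx_snocE: "wf_ctx (\<Gamma> @ [A])"
inductive_cases wf_ty_ArrowE: "wf_ty \<Gamma> (Arrow A t u)"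
inductive_cases wf_ty_StarE: "wf_ty \<Gamma> Star"
inductive_cases wf_tmE: "wf_tm \<Gamma> t A"

lemma wf_tm_iff: "wf_tm \<Gamma> t A \<longleftrightarrow> wf_ctx \<Gamma> \<and> (\<exists>i<length \<Gamma>. t = Var i \<and> A = \<Gamma> ! i)"
  by (auto elim: wf_tmE intro: tm_var)

lemma wf_ty_wf_ctx: "wf_ty \<Gamma> A \<Longrightarrow> wf_ctx \<Gamma>"
  by (induction A) (auto elim: wf_ty_ArrowE wf_ty_StarE)

lemma wf_ty_Star [simp]: "wf_ty \<Gamma> Star \<longleftrightarrow> wf_ctx \<Gamma>"
  by (auto elim: wf_ty_StarE intro: ty_star)

lemma wf_ty_Arrow [simp]: "wf_ty \<Gamma> (Arrow A t u) \<longleftrightarrow> wf_ty \<Gamma> A \<and> wf_tm \<Gamma> t A \<and> wf_tm \<Gamma> u A"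
  by (auto elim: wf_ty_ArrowE intro: ty_arrow)

lemma wf_ctx_Nil [simp]: "wf_ctx []"
  by (rule ctx_empty)

lemma wf_ctx_snoc [simp]: "wf_ctx (\<Gamma> @ [A]) \<longleftrightarrow> wf_ty \<Gamma> A"
  by (auto elim: wf_ctx_snocE intro: ctx_ext wf_ty_wf_ctx)

lemma wf_tm_weaken: "\<lbrakk>wf_tm \<Gamma> t A; wf_ty \<Gamma> B\<rbrakk> \<Longrightarrow> wf_tm (\<Gamma> @ [B]) t A"
  by (fastforce simp: wf_tm_iff nth_append)

lemma wf_ty_weaken: "\<lbrakk>wf_ty \<Gamma> A; wf_ty \<Gamma> B\<rbrakk> \<Longrightarrow> wf_ty (\<Gamma> @ [B]) A"
  by (induction A) (auto intro: wf_tm_weaken)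

lemma wf_ctx_nth: "\<lbrakk>wf_ctx \<Gamma>; i < length \<Gamma>\<rbrakk> \<Longrightarrow> wf_ty \<Gamma> (\<Gamma> ! i)"
proof (induction \<Gamma> rule: rev_induct)
  case (snoc A \<Gamma>)
  then show ?case
    by (cases "i = length \<Gamma>") (auto simp: nth_append dest: wf_ty_wf_ctx intro: wf_ty_weaken)
qed simp

lemma wf_tm_wf_ty: "wf_tm \<Gamma> t A \<Longrightarrow> wf_ty \<Gamma> A"
  by (auto simp: wf_tm_iff intro: wf_ctx_nth)

lemma subst_tm_cong:
  "\<lbrakk>wf_tm \<Gamma> t A; \<And>i. i < length \<Gamma> \<Longrightarrow> \<gamma> ! i = \<delta> ! i\<rbrakk> \<Longrightarrow> subst_tm \<gamma> t = subst_tm \<delta> t"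
  by (auto simp: wf_tm_iff)

lemma subst_ty_cong:
  "\<lbrakk>wf_ty \<Gamma> A; \<And>i. i < length \<Gamma> \<Longrightarrow> \<gamma> ! i = \<delta> ! i\<rbrakk> \<Longrightarrow> subst_ty \<gamma> A = subst_ty \<delta> A"
  by (induction A) (auto intro: subst_tm_cong)

lemma subst_ty_append: "\<lbrakk>wf_ty \<Gamma> A; length \<gamma> = length \<Gamma>\<rbrakk> \<Longrightarrow> subst_ty (\<gamma> @ \<delta>) A = subst_ty \<gamma> A"
  by (erule subst_ty_cong) (simp add: nth_append)

lemma subst_ty_append_nth:
  assumes "wf_ctx \<Gamma>" "length \<gamma> = length \<Gamma>" "i < length \<Gamma>"
  shows "subst_ty (\<gamma> @ \<delta>) (\<Gamma> ! i) = subst_ty \<gamma> (\<Gamma> ! i)"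
  by (rule subst_ty_append[OF wf_ctx_nth]) (use assms in auto)

text \<open>The inductive rule types each entry against the entries before it, the right-hand side
  against all of \<open>\<gamma>\<close>. The two agree because with de Bruijn levels appending an
  entry does not affect the types declared earlier (\<open>subst_ty_append_nth\<close>). The
  pointwise form avoids further rule inductions.\<close>

lemma wf_sub_iff:
  "wf_sub \<Delta> \<gamma> \<Gamma> \<longleftrightarrow> wf_ctx \<Delta> \<and> wf_ctx \<Gamma> \<and> length \<gamma> = length \<Gamma> \<and>
     (\<forall>i<length \<Gamma>. wf_tm \<Delta> (\<gamma> ! i) (subst_ty \<gamma> (\<Gamma> ! i)))"  (is "?L \<longleftrightarrow> ?R")
proof
  show "?L \<Longrightarrow> ?R"
  proof (induction rule: wf_sub.induct)
    case (sub_ext \<Delta> \<gamma> \<Gamma> A t)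
    then show ?case
      by (auto simp: nth_append less_Suc_eq subst_ty_append subst_ty_append_nth)
  qed simp
next
  show "?R \<Longrightarrow> ?L"
  proof (induction \<Gamma> arbitrary: \<gamma> rule: rev_induct)
    case Nil
    then show ?case by (simp add: sub_empty)
  next
    case (snoc A \<Gamma>)
    then obtain \<gamma>' t where \<gamma>: "\<gamma> = \<gamma>' @ [t]" "length \<gamma>' = length \<Gamma>"
      by (cases \<gamma> rule: rev_cases) auto
    have A: "wf_ty \<Gamma> A" "wf_ctx \<Gamma>" "wf_ctx \<Delta>" using snoc.prems by (auto dest: wf_ty_wf_ctx)
    have tm: "wf_tm \<Delta> (\<gamma> ! i) (subst_ty \<gamma> ((\<Gamma> @ [A]) ! i))" if "i \<le> length \<Gamma>" for i
      using snoc.prems that by auto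
    have "wf_tm \<Delta> (\<gamma>' ! i) (subst_ty \<gamma>' (\<Gamma> ! i))" if "i < length \<Gamma>" for i
      using tm[of i] that \<gamma> A by (simp add: nth_append subst_ty_append_nth)
    moreover have "wf_tm \<Delta> t (subst_ty \<gamma>' A)"
      using tm[of "length \<Gamma>"] \<gamma> A by (simp add: nth_append subst_ty_append)
    ultimately show ?case using snoc.IH[of \<gamma>'] A \<gamma> by (auto intro: sub_ext)
  qed
qed

lemma wf_sub_length: "wf_sub \<Delta> \<gamma> \<Gamma> \<Longrightarrow> length \<gamma> = length \<Gamma>"
  by (simp add: wf_sub_iff)

lemma wf_sub_snoc:
  "wf_sub \<Delta> \<gamma> (\<Gamma> @ [A]) \<longleftrightarrow>
     (\<exists>\<gamma>' t. \<gamma> = \<gamma>' @ [t] \<and> wf_sub \<Delta> \<gamma>' \<Gamma> \<and> wf_ty \<Gamma> A \<and> wf_tm \<Delta> t (subst_ty \<gamma>' A))"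
  by (auto elim: wf_sub.cases intro: sub_ext)

lemma wf_sub_Nil [simp]: "wf_sub \<Delta> \<gamma> [] \<longleftrightarrow> wf_ctx \<Delta> \<and> \<gamma> = []"
  by (auto simp: wf_sub_iff)

lemma wf_tm_subst: "\<lbrakk>wf_tm \<Gamma> t A; wf_sub \<Delta> \<gamma> \<Gamma>\<rbrakk> \<Longrightarrow> wf_tm \<Delta> (subst_tm \<gamma> t) (subst_ty \<gamma> A)"
  by (auto simp: wf_tm_iff[of \<Gamma>] wf_sub_iff)

lemma wf_ty_subst: "\<lbrakk>wf_ty \<Gamma> A; wf_sub \<Delta> \<gamma> \<Gamma>\<rbrakk> \<Longrightarrow> wf_ty \<Delta> (subst_ty \<gamma> A)"
  by (induction A) (auto intro: wf_tm_subst simp: wf_sub_iff)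

lemma length_subst_comp [simp]: "length (subst_comp \<gamma> \<delta>) = length \<gamma>"
  by (simp add: subst_comp_def)

lemma subst_comp_append [simp]: "subst_comp (\<gamma> @ \<gamma>') \<delta> = subst_comp \<gamma> \<delta> @ subst_comp \<gamma>' \<delta>"
  by (simp add: subst_comp_def)

lemma subst_comp_Cons [simp]: "subst_comp (t # \<gamma>) \<delta> = subst_tm \<delta> t # subst_comp \<gamma> \<delta>"
  by (simp add: subst_comp_def)

lemma subst_comp_Nil [simp]: "subst_comp [] \<delta> = []"
  by (simp add: subst_comp_def)

lemma nth_subst_comp [simp]: "i < length \<gamma> \<Longrightarrow> subst_comp \<gamma> \<delta> ! i = subst_tm \<delta> (\<gamma> ! i)"
  by (simp add: subst_comp_def)

lemma length_subst_id [simp]: "length (subst_id k) = k"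
  by (simp add: subst_id_def)

lemma nth_subst_id [simp]: "i < k \<Longrightarrow> subst_id k ! i = Var i"
  by (simp add: subst_id_def)

lemma subst_id_Suc: "subst_id (Suc k) = subst_id k @ [Var k]"
  by (simp add: subst_id_def)

text \<open>Context projections are of the form \<open>subst_id k\<close>, so composing with them
  truncates a list. Most equations about the syntactic structure reduce to this.\<close>

lemma subst_comp_id_take: "k \<le> length \<delta> \<Longrightarrow> subst_comp (subst_id k) \<delta> = take k \<delta>"
  by (rule nth_equalityI) auto

lemma subst_tm_comp:
  "\<lbrakk>wf_tm \<Gamma> t A; length \<gamma> = length \<Gamma>\<rbrakk> \<Longrightarrow> subst_tm (subst_comp \<gamma> \<delta>) t = subst_tm \<delta> (subst_tm \<gamma> t)"
  by (auto simp: wf_tm_iff)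

lemma subst_ty_comp:
  "\<lbrakk>wf_ty \<Gamma> A; length \<gamma> = length \<Gamma>\<rbrakk> \<Longrightarrow> subst_ty (subst_comp \<gamma> \<delta>) A = subst_ty \<delta> (subst_ty \<gamma> A)"
  by (induction A) (auto intro: subst_tm_comp)

lemma subst_tm_id: "\<lbrakk>wf_tm \<Gamma> t A; length \<Gamma> \<le> k\<rbrakk> \<Longrightarrow> subst_tm (subst_id k) t = t"
  by (auto simp: wf_tm_iff)

lemma subst_ty_id: "\<lbrakk>wf_ty \<Gamma> A; length \<Gamma> \<le> k\<rbrakk> \<Longrightarrow> subst_ty (subst_id k) A = A"
  by (induction A) (auto intro: subst_tm_id)

lemma wf_sub_comp: "\<lbrakk>wf_sub \<Theta> \<delta> \<Delta>; wf_sub \<Delta> \<gamma> \<Gamma>\<rbrakk> \<Longrightarrow> wf_sub \<Theta> (subst_comp \<gamma> \<delta>) \<Gamma>"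
  unfolding wf_sub_iff[of _ _ \<Gamma>]
  by (auto simp: subst_ty_comp[OF wf_ctx_nth] intro!: wf_tm_subst) (simp add: wf_sub_iff)

lemma wf_sub_id: "wf_ctx \<Gamma> \<Longrightarrow> wf_sub \<Gamma> (subst_id (length \<Gamma>)) \<Gamma>"
  by (auto simp: wf_sub_iff subst_ty_id[OF wf_ctx_nth] tm_var)

lemma wf_sub_weaken: "\<lbrakk>wf_sub \<Delta> \<gamma> \<Gamma>; wf_ty \<Delta> B\<rbrakk> \<Longrightarrow> wf_sub (\<Delta> @ [B]) \<gamma> \<Gamma>"
  by (auto simp: wf_sub_iff intro: wf_tm_weaken)

lemma wf_sub_proj: "wf_ty \<Gamma> A \<Longrightarrow> wf_sub (\<Gamma> @ [A]) (subst_id (length \<Gamma>)) \<Gamma>"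
  by (intro wf_sub_weaken wf_sub_id) (auto dest: wf_ty_wf_ctx)

lemma wf_tm_last: "wf_ty \<Gamma> A \<Longrightarrow> wf_tm (\<Gamma> @ [A]) (Var (length \<Gamma>)) A"
  by (auto simp: wf_tm_iff nth_append intro: wf_ty_wf_ctx)

lemma subst_comp_id_right: "wf_sub \<Delta> \<gamma> \<Gamma> \<Longrightarrow> subst_comp \<gamma> (subst_id (length \<Delta>)) = \<gamma>"
  by (rule nth_equalityI) (auto simp: wf_sub_iff intro: subst_tm_id)

lemma subst_comp_assoc:
  "\<lbrakk>wf_sub \<Theta> \<delta> \<Delta>; wf_sub \<Delta> \<gamma> \<Gamma>\<rbrakk>
    \<Longrightarrow> subst_comp (subst_comp \<gamma> \<delta>) \<epsilon> = subst_comp \<gamma> (subst_comp \<delta> \<epsilon>)"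
  by (rule nth_equalityI) (auto simp: wf_sub_iff subst_tm_comp)

section \<open>Unfolding the syntactic category and its comprehension\<close>

lemma Syn_Glob_simps [simp]:
  "Obj Syn_Glob = {\<Gamma>. wf_ctx \<Gamma>}"
  "Dom Syn_Glob (\<Delta>, \<gamma>, \<Gamma>) = \<Delta>"
  "Cod Syn_Glob (\<Delta>, \<gamma>, \<Gamma>) = \<Gamma>"
  "Ide Syn_Glob \<Gamma> = (\<Gamma>, subst_id (length \<Gamma>), \<Gamma>)"
  "Comp Syn_Glob (\<Delta>, \<gamma>, \<Gamma>) (\<Theta>, \<delta>, \<Delta>') = (\<Theta>, subst_comp \<gamma> \<delta>, \<Gamma>)"
  "Ty Syn_Glob \<Gamma> = {A. wf_ty \<Gamma> A}"
  "Tm Syn_Glob \<Gamma> A = {t. wf_tm \<Gamma> t A}"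
  "tysub Syn_Glob (\<Delta>, \<gamma>, \<Gamma>) A = subst_ty \<gamma> A"
  "tmsub Syn_Glob (\<Delta>, \<gamma>, \<Gamma>) A t = subst_tm \<gamma> t"
  "One Syn_Glob = []"
  "Ext Syn_Glob \<Gamma> A = \<Gamma> @ [A]"
  "Proj Syn_Glob \<Gamma> A = (\<Gamma> @ [A], subst_id (length \<Gamma>), \<Gamma>)"
  "Gen Syn_Glob \<Gamma> A = Var (length \<Gamma>)"
  "fob (Disk Syn_Glob) n = disk_ctx n"
  "farr (Disk Syn_Glob) (n, p) = (disk_ctx (n + path_length p), path_sub n p, disk_ctx n)"
  "Sph Syn_Glob = sph_ctx"
  "SphL Syn_Glob n = (sph_ctx (Suc n), subst_id (2 * n) @ [Var (2 * n)], disk_ctx n)"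
  "SphR Syn_Glob n = (sph_ctx (Suc n), subst_id (2 * n) @ [Var (2 * n + 1)], disk_ctx n)"
  "GTy Syn_Glob n (\<Delta>, \<gamma>, \<Gamma>) = subst_ty \<gamma> (U_ty n)"
  "DiskIso Syn_Glob n = (disk_ctx n, subst_id (2 * n + 1), disk_ctx n)"
  by (simp_all add: Syn_Glob_def)

lemma Arr_Syn_Glob [simp]: "(\<Delta>, \<gamma>, \<Gamma>) \<in> Arr Syn_Glob \<longleftrightarrow> wf_sub \<Delta> \<gamma> \<Gamma>"
  by (simp add: Syn_Glob_def)

lemma hom_Syn_Glob [simp]:
  "(\<Delta>', \<gamma>, \<Gamma>') \<in> hom Syn_Glob \<Delta> \<Gamma> \<longleftrightarrow> \<Delta>' = \<Delta> \<and> \<Gamma>' = \<Gamma> \<and> wf_sub \<Delta> \<gamma> \<Gamma>"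
  by (auto simp: hom_def)

lemma hom_Syn_GlobE:
  assumes "f \<in> hom Syn_Glob \<Delta> \<Gamma>"
  obtains \<gamma> where "f = (\<Delta>, \<gamma>, \<Gamma>)" "wf_sub \<Delta> \<gamma> \<Gamma>"
  using assms by (cases f) auto

lemma cwf_Syn_Glob: "cwf Syn_Glob"
proof
  fix f assume "f \<in> Arr Syn_Glob"
  then show "Dom Syn_Glob f \<in> Obj Syn_Glob" "Cod Syn_Glob f \<in> Obj Syn_Glob"
    by (cases f; simp add: wf_sub_iff)+
next
  fix \<Gamma> A \<sigma> \<Delta> a
  assume "\<Gamma> \<in> Obj Syn_Glob" "A \<in> Ty Syn_Glob \<Gamma>" "\<sigma> \<in> hom Syn_Glob \<Delta> \<Gamma>"
    "a \<in> Tm Syn_Glob \<Delta> (tysub Syn_Glob \<sigma> A)"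
  then obtain \<gamma> where \<sigma>: "\<sigma> = (\<Delta>, \<gamma>, \<Gamma>)" "wf_sub \<Delta> \<gamma> \<Gamma>" "wf_ty \<Gamma> A" "wf_tm \<Delta> a (subst_ty \<gamma> A)"
    by (auto elim!: hom_Syn_GlobE)
  show "\<exists>!u. u \<in> hom Syn_Glob \<Delta> (Ext Syn_Glob \<Gamma> A) \<and> Comp Syn_Glob (Proj Syn_Glob \<Gamma> A) u = \<sigma> \<and>
      tmsub Syn_Glob u (tysub Syn_Glob (Proj Syn_Glob \<Gamma> A) A) (Gen Syn_Glob \<Gamma> A) = a"
  proof (rule ex1I[of _ "(\<Delta>, \<gamma> @ [a], \<Gamma> @ [A])"])
    show "(\<Delta>, \<gamma> @ [a], \<Gamma> @ [A]) \<in> hom Syn_Glob \<Delta> (Ext Syn_Glob \<Gamma> A) \<and>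
      Comp Syn_Glob (Proj Syn_Glob \<Gamma> A) (\<Delta>, \<gamma> @ [a], \<Gamma> @ [A]) = \<sigma> \<and>
      tmsub Syn_Glob (\<Delta>, \<gamma> @ [a], \<Gamma> @ [A]) (tysub Syn_Glob (Proj Syn_Glob \<Gamma> A) A)
        (Gen Syn_Glob \<Gamma> A) = a"
      using \<sigma> by (auto simp: wf_sub_snoc subst_comp_id_take wf_sub_length nth_append)
  qed (auto simp: \<sigma> wf_sub_snoc subst_comp_id_take wf_sub_length nth_append elim!: hom_Syn_GlobE)
qed (auto elim!: hom_Syn_GlobE
     simp: wf_sub_id wf_sub_comp subst_comp_id_right subst_comp_id_take wf_sub_length
       subst_comp_assoc wf_ty_subst wf_tm_subst subst_ty_id subst_tm_id subst_ty_comp subst_tm_comp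
       wf_sub_proj wf_tm_last
     intro: wf_ty_wf_ctx)

section \<open>Sphere and disk contexts and their boundary substitutions\<close>

lemma length_sph_ctx [simp]: "length (sph_ctx n) = 2 * n"
  by (induction n) auto

lemma length_disk_ctx [simp]: "length (disk_ctx n) = Suc (2 * n)"
  by (simp add: disk_ctx_def)

text \<open>Replaces the defining equation as a simp rule: seen as a disk with one more cell, the
  sphere has \<open>SphL\<close> as an ordinary context projection.\<close>

lemma sph_ctx_Suc [simp]: "sph_ctx (Suc n) = disk_ctx n @ [U_ty n]"
  by (simp add: disk_ctx_def)

declare sph_ctx.simps(2) [simp del]

lemma nth_disk_ctx [simp]: "disk_ctx n ! (2 * n) = U_ty n"
  by (simp add: disk_ctx_def nth_append)

text \<open>The endpoints of \<open>U_ty (Suc n)\<close> are the last two variables of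
  \<open>sph_ctx (Suc n)\<close>, both declared with type \<open>U_ty n\<close>; weakening leaves
  raw types unchanged.\<close>

lemma wf_U_ty: "wf_ty (sph_ctx n) (U_ty n)"
proof (induction n)
  case (Suc n)
  have D: "wf_ty (disk_ctx n) (U_ty n)"
    unfolding disk_ctx_def using Suc by (intro wf_ty_weaken)
  then have "wf_ty (sph_ctx (Suc n)) (U_ty n)"
    by (auto intro: wf_ty_weaken)
  then show ?case
    using D by (auto simp: wf_tm_iff nth_append)
qed simp

lemma wf_sph_ctx [simp]: "wf_ctx (sph_ctx n)"
  by (rule wf_ty_wf_ctx[OF wf_U_ty])

lemma wf_U_ty_disk: "wf_ty (disk_ctx n) (U_ty n)"
  by (simp add: disk_ctx_def wf_U_ty wf_ty_weaken)

lemma wf_disk_ctx [simp]: "wf_ctx (disk_ctx n)"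
  by (rule wf_ty_wf_ctx[OF wf_U_ty_disk])

lemma wf_sub_disk_iff:
  "wf_sub \<Delta> \<gamma> (disk_ctx n) \<longleftrightarrow>
     (\<exists>\<gamma>' t. \<gamma> = \<gamma>' @ [t] \<and> wf_sub \<Delta> \<gamma>' (sph_ctx n) \<and> wf_tm \<Delta> t (subst_ty \<gamma>' (U_ty n)))"
  by (simp add: disk_ctx_def wf_sub_snoc wf_U_ty)

lemma wf_sub_sph_Suc_iff:
  "wf_sub \<Delta> \<gamma> (sph_ctx (Suc n)) \<longleftrightarrow>
     (\<exists>\<gamma>' t u. \<gamma> = \<gamma>' @ [t, u] \<and> wf_sub \<Delta> \<gamma>' (sph_ctx n) \<and>
        wf_tm \<Delta> t (subst_ty \<gamma>' (U_ty n)) \<and> wf_tm \<Delta> u (subst_ty \<gamma>' (U_ty n)))"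
  by (fastforce simp: wf_sub_snoc wf_sub_disk_iff wf_U_ty_disk wf_sub_length
      subst_ty_append[OF wf_U_ty])

lemma wf_sub_SphL: "wf_sub (sph_ctx (Suc n)) (subst_id (2 * n) @ [Var (2 * n)]) (disk_ctx n)"
  using wf_sub_proj[OF wf_U_ty_disk[of n]] by (simp add: subst_id_Suc)

lemma wf_sub_SphR: "wf_sub (sph_ctx (Suc n)) (subst_id (2 * n) @ [Var (2 * n + 1)]) (disk_ctx n)"
  using wf_sub_SphL[of n] wf_tm_last[OF wf_U_ty_disk[of n]] wf_U_ty[of n]
  by (simp add: wf_sub_disk_iff subst_ty_id)

text \<open>The boundary substitutions of the disk are the two sphere projections, weakened by the
  top cell.\<close>

lemma wf_gen_sub: "wf_sub (disk_ctx (Suc n)) (gen_sub n g) (disk_ctx n)"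
  using wf_sub_weaken[OF wf_sub_SphL wf_U_ty] wf_sub_weaken[OF wf_sub_SphR wf_U_ty]
  by (cases g) (simp_all add: disk_ctx_def[of "Suc n"])

lemma wf_word_sub: "wf_sub (disk_ctx (n + length w)) (word_sub n w) (disk_ctx n)"
proof (induction w arbitrary: n)
  case Nil
  show ?case using wf_sub_id[of "disk_ctx n"] by simp
next
  case (Cons g w)
  show ?case using wf_sub_comp[OF Cons[of "Suc n"] wf_gen_sub] by simp
qed

lemma wf_path_sub: "wf_sub (disk_ctx (n + path_length p)) (path_sub n p) (disk_ctx n)"
  by transfer (rule wf_word_sub)

lemma word_sub_append:
  "word_sub n (u @ v) = subst_comp (word_sub n u) (word_sub (n + length u) v)"
proof (induction u arbitrary: n)
  case Nil
  show ?case by (simp add: subst_comp_id_take length_word_sub)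
next
  case (Cons g u)
  show ?case
    using subst_comp_assoc[OF wf_word_sub[of "Suc n" u] wf_gen_sub[of n g]] Cons[of "Suc n"] by simp
qed

lemma path_sub_append:
  "path_sub n (path_append p q) = subst_comp (path_sub n p) (path_sub (n + path_length p) q)"
  by transfer (rule word_sub_append)

lemma path_length_append [simp]: "path_length (path_append p q) = path_length p + path_length q"
  by transfer simp

lemma path_length_nil [simp]: "path_length path_nil = 0"
  by transfer simp

lemma path_length_gen [simp]: "path_length (path_gen g) = 1"
  by transfer simp

lemma path_sub_nil [simp]: "path_sub n path_nil = subst_id (2 * n + 1)"
  by transfer simp

lemma path_sub_gen [simp]: "path_sub n (path_gen g) = gen_sub n g"
  by transfer (use wf_gen_sub subst_comp_id_right in fastforce)

lemma opposite_Globe_simps [simp]: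
  "Obj (opposite Globe) = UNIV" "Arr (opposite Globe) = UNIV"
  "Dom (opposite Globe) (i, p) = i + path_length p" "Cod (opposite Globe) (i, p) = i"
  "Ide (opposite Globe) i = (i, path_nil)"
  "Comp (opposite Globe) (i, p) (j, q) = (i, path_append p q)"
  by (simp_all add: opposite_def Globe_def)

text \<open>Paths form a quotient without constructors; this is list induction on a representing
  word, with the generator applied first in \<open>Globe\<close> split off.\<close>

lemma path_induct [case_names nil gen]:
  assumes "\<And>i. P (i, path_nil)"
    and "\<And>i g p. P (Suc i, p) \<Longrightarrow> P (i, path_append (path_gen g) p)"
  shows "P (f :: glob_arr)"
proof -
  obtain i p where f: "f = (i, p)" by force
  have "P (i, abs_glob_path w)" for w
  proof (induction w arbitrary: i)
    case Nil
    then show ?case using assms(1) by (simp add: path_nil_def)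
  next
    case (Cons g w)
    then have "P (i, path_append (path_gen g) (abs_glob_path w))"
      by (intro assms(2))
    then show ?case by (simp add: path_append.abs_eq path_gen.abs_eq)
  qed
  then show ?thesis unfolding f by (metis Quotient3_glob_path Quotient3_def)
qed

section \<open>The globular structure of the syntactic category\<close>

lemma Disk_Syn_Glob_functor: "is_functor (opposite Globe) Syn_Glob (Disk Syn_Glob)"
  by (auto simp: is_functor_def wf_path_sub path_sub_append add.assoc)

text \<open>The source map is a composite of two projections. The target map becomes one after
  \<open>?w\<close>, which exchanges the two parallel cells of the sphere; \<open>?w\<close> is its
  own inverse, so closure of display maps under isomorphism applies.\<close>

lemma display_gen: "display Syn_Glob (disk_ctx (Suc n), gen_sub n g, disk_ctx n)"
proof -
  interpret cwf Syn_Glob by (rule cwf_Syn_Glob)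
  let ?S = "sph_ctx (Suc n)"
  let ?w = "(?S, subst_id (2 * n) @ [Var (2 * n + 1), Var (2 * n)], ?S)"
  let ?p = "Proj Syn_Glob ?S (U_ty (Suc n))"
  let ?q = "Proj Syn_Glob (disk_ctx n) (U_ty n)"
  have p: "display Syn_Glob ?p" using wf_U_ty[of "Suc n"] wf_U_ty_disk[of n]
    by (intro display.proj) auto
  have q: "display Syn_Glob ?q" using wf_U_ty_disk[of n] by (intro display.proj) auto
  have w: "?w \<in> hom Syn_Glob ?S ?S"
    using wf_sub_SphL[of n] wf_sub_SphR[of n]
    by (simp add: wf_sub_sph_Suc_iff wf_sub_disk_iff del: sph_ctx_Suc)
  have ww: "Comp Syn_Glob ?w ?w = Ide Syn_Glob ?S"
    by (simp add: subst_comp_id_take nth_append subst_id_Suc)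
  have "is_iso Syn_Glob ?w" unfolding is_iso_def using w ww
    by (intro conjI bexI[of _ ?w]) simp_all
  moreover have "is_iso Syn_Glob (Ide Syn_Glob (disk_ctx n))"
    unfolding is_iso_def using wf_sub_id[of "disk_ctx n"]
    by (auto simp: subst_comp_id_take intro!: bexI[of _ "Ide Syn_Glob (disk_ctx n)"])
  ultimately have t: "display Syn_Glob (Comp Syn_Glob (Ide Syn_Glob (disk_ctx n)) (Comp Syn_Glob ?q ?w))"
    by (intro display.iso q) (auto simp: sph_ctx_Suc)
  show ?thesis
  proof (cases g)
    case Sigma_gen
    have "display Syn_Glob (Comp Syn_Glob ?q ?p)"
      by (intro display.comp p q) (simp add: sph_ctx_Suc)
    then show ?thesis
      by (simp add: Sigma_gen subst_comp_id_take nth_append subst_id_Suc disk_ctx_def[of "Suc n"])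
  next
    case Tau_gen
    have "display Syn_Glob (Comp Syn_Glob (Comp Syn_Glob (Ide Syn_Glob (disk_ctx n)) (Comp Syn_Glob ?q ?w)) ?p)"
      by (intro display.comp p t) (simp add: sph_ctx_Suc)
    then show ?thesis
      by (simp add: Tau_gen subst_comp_id_take nth_append subst_id_Suc disk_ctx_def[of "Suc n"])
  qed
qed

lemma display_Disk_Syn_Glob: "display Syn_Glob (farr (Disk Syn_Glob) f)"
proof (induction f rule: path_induct)
  case (nil i)
  show ?case using display.ident[of "disk_ctx i" Syn_Glob] by simp
next
  case (gen i g p)
  show ?case
    using display.comp[OF gen display_gen[of i g]] by (simp add: path_sub_append)
qed

text \<open>For uniqueness in the successor case: composing with \<open>SphL\<close> reads off
  everything except the last entry of a substitution into the sphere, and composing with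
  \<open>SphR\<close> reads off that last entry.\<close>

lemma tymap_Syn_Glob: "tymap Syn_Glob n = (disk_ctx n, subst_id (2 * n), sph_ctx n)"
proof (cases n)
  case 0
  then show ?thesis
    by (auto simp: subst_id_def intro!: the_equality elim!: hom_Syn_GlobE)
next
  case (Suc m)
  let ?P = "\<lambda>u. u \<in> hom Syn_Glob (disk_ctx n) (sph_ctx n) \<and>
    Comp Syn_Glob (SphL Syn_Glob m) u = farr (Disk Syn_Glob) (glob_sigma m) \<and>
    Comp Syn_Glob (SphR Syn_Glob m) u = farr (Disk Syn_Glob) (glob_tau m)"
  have "?P (disk_ctx n, subst_id (2 * n), sph_ctx n)"
    using wf_sub_proj[OF wf_U_ty[of "Suc m"]]
    by (simp add: Suc glob_sigma_def glob_tau_def subst_comp_id_take subst_id_Suc nth_append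
        disk_ctx_def[of "Suc m"])
  moreover have "u = (disk_ctx n, subst_id (2 * n), sph_ctx n)" if P: "?P u" for u
  proof -
    obtain \<gamma> where u: "u = (disk_ctx n, \<gamma>, sph_ctx n)" "wf_sub (disk_ctx n) \<gamma> (sph_ctx n)"
      using P by (auto elim: hom_Syn_GlobE)
    then show ?thesis using P unfolding Suc wf_sub_sph_Suc_iff
      by (auto simp: glob_sigma_def glob_tau_def subst_comp_id_take subst_id_Suc nth_append
          wf_sub_length simp del: sph_ctx_Suc)
  qed
  ultimately have "(THE u. ?P u) = (disk_ctx n, subst_id (2 * n), sph_ctx n)"
    by (rule the_equality)
  then show ?thesis by (simp add: Suc)
qed

lemma Sph_Syn_Glob_pullback:
  "is_pullback Syn_Glob (tymap Syn_Glob n) (tymap Syn_Glob n) (Sph Syn_Glob (Suc n))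
     (SphL Syn_Glob n) (SphR Syn_Glob n)"
  unfolding is_pullback_def
proof (intro conjI ballI impI)
  fix X x y
  assume X: "X \<in> Obj Syn_Glob"
    and "x \<in> hom Syn_Glob X (Dom Syn_Glob (tymap Syn_Glob n))"
    and "y \<in> hom Syn_Glob X (Dom Syn_Glob (tymap Syn_Glob n))"
    and eq: "Comp Syn_Glob (tymap Syn_Glob n) x = Comp Syn_Glob (tymap Syn_Glob n) y"
  then obtain \<gamma> a \<delta> b where x: "x = (X, \<gamma> @ [a], disk_ctx n)" "wf_sub X \<gamma> (sph_ctx n)"
      "wf_tm X a (subst_ty \<gamma> (U_ty n))"
    and y: "y = (X, \<delta> @ [b], disk_ctx n)" "wf_sub X \<delta> (sph_ctx n)"
      "wf_tm X b (subst_ty \<delta> (U_ty n))"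
    by (auto simp: tymap_Syn_Glob wf_sub_disk_iff elim!: hom_Syn_GlobE)
  have [simp]: "length \<gamma> = 2 * n" "length \<delta> = 2 * n" using x y by (simp_all add: wf_sub_length)
  \<comment> \<open>\<open>tymap\<close> drops the last entry, so equal boundaries mean equal
    prefixes, and the two top cells can be appended to the common prefix.\<close>
  have [simp]: "\<delta> = \<gamma>" using eq x y by (simp add: tymap_Syn_Glob subst_comp_id_take)
  have ab: "wf_sub X (\<gamma> @ [a, b]) (sph_ctx (Suc n))"
    using x y by (simp add: wf_sub_sph_Suc_iff del: sph_ctx_Suc)
  show "\<exists>!u. u \<in> hom Syn_Glob X (Sph Syn_Glob (Suc n)) \<and> Comp Syn_Glob (SphL Syn_Glob n) u = x \<and>
      Comp Syn_Glob (SphR Syn_Glob n) u = y"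
  proof (rule ex1I[of _ "(X, \<gamma> @ [a, b], sph_ctx (Suc n))"], goal_cases)
    case 1
    then show ?case using ab x y by (simp add: subst_comp_id_take nth_append del: sph_ctx_Suc)
  next
    case (2 u)
    then obtain \<epsilon> where u: "u = (X, \<epsilon>, sph_ctx (Suc n))" "wf_sub X \<epsilon> (sph_ctx (Suc n))"
      by (auto elim: hom_Syn_GlobE)
    then show ?case using 2 x y
      by (auto simp: wf_sub_sph_Suc_iff subst_comp_id_take nth_append wf_sub_length
          simp del: sph_ctx_Suc)
  qed
qed (use wf_sub_SphL[of n] wf_sub_SphR[of n] wf_sub_proj[OF wf_U_ty[of n]] in
    \<open>auto simp: tymap_Syn_Glob subst_comp_id_take nth_append disk_ctx_def[symmetric]\<close>)

lemma globular_cwf_Syn_Glob: "globular_cwf Syn_Glob"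
proof -
  interpret cwf Syn_Glob by (rule cwf_Syn_Glob)
  show ?thesis
  proof
    fix n
    show "is_iso Syn_Glob (DiskIso Syn_Glob n)"
      unfolding is_iso_def using wf_sub_id[of "disk_ctx n"]
      by (auto simp: subst_comp_id_take intro!: bexI[of _ "Ide Syn_Glob (disk_ctx n)"])
    show "DiskIso Syn_Glob n \<in> hom Syn_Glob (Ext Syn_Glob (Sph Syn_Glob n)
        (GTy Syn_Glob n (Ide Syn_Glob (Sph Syn_Glob n)))) (fob (Disk Syn_Glob) n)"
      using wf_sub_id[OF wf_disk_ctx[of n]] by (simp add: subst_ty_id[OF wf_U_ty] disk_ctx_def)
    show "Comp Syn_Glob (tymap Syn_Glob n) (DiskIso Syn_Glob n) =
      Proj Syn_Glob (Sph Syn_Glob n) (GTy Syn_Glob n (Ide Syn_Glob (Sph Syn_Glob n)))"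
      by (simp add: subst_ty_id[OF wf_U_ty] disk_ctx_def tymap_Syn_Glob subst_comp_id_take
          subst_id_Suc)
  qed (use display_Disk_Syn_Glob Disk_Syn_Glob_functor Sph_Syn_Glob_pullback in
      \<open>auto elim!: hom_Syn_GlobE intro: wf_ty_subst[OF wf_U_ty] simp: subst_ty_comp[OF wf_U_ty] wf_sub_length\<close>)
qed

section \<open>Disk maps and terms in a globular category with families\<close>

context category
begin

lemma hom_Obj: "f \<in> hom C a b \<Longrightarrow> a \<in> Obj C" "f \<in> hom C a b \<Longrightarrow> b \<in> Obj C"
  using Dom_in Cod_in by (auto simp: hom_def)

lemma hom_Dom: "f \<in> hom C a b \<Longrightarrow> Dom C f = a"
  by (simp add: hom_def)

text \<open>The Yoneda argument: lifting the identity along \<open>f\<close> gives a right inverse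
  \<open>g\<close>, and \<open>g \<cdot> f\<close> and the identity are both lifts of
  \<open>f\<close> through itself.\<close>

lemma is_isoI_representable:
  assumes f: "f \<in> hom C a b"
    and ex1: "\<And>Y d. d \<in> hom C Y b \<Longrightarrow> \<exists>!u. u \<in> hom C Y a \<and> f \<cdot> u = d"
  shows "is_iso C f"
proof -
  have ab: "a \<in> Obj C" "b \<in> Obj C" using f hom_Obj by blast+
  obtain g where g: "g \<in> hom C b a" "f \<cdot> g = Ide C b"
    using ex1[OF Ide_in] ab by blast
  have "f \<cdot> (g \<cdot> f) = f"
    using Comp_assoc[OF f g(1) f] g(2) Ide_Comp[OF f] by simp
  moreover have "g \<cdot> f \<in> hom C a a" using f g Comp_in by blast
  ultimately have "g \<cdot> f = Ide C a"
    using ex1[OF f] Ide_in[OF ab(1)] Comp_Ide[OF f] by blast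
  then show ?thesis
    unfolding is_iso_def using f g by (auto simp: hom_def)
qed

end

section \<open>Consequences of the universal property of comprehension\<close>

context cwf
begin

lemma to_One_unique: "\<lbrakk>u \<in> hom C X (One C); v \<in> hom C X (One C)\<rbrakk> \<Longrightarrow> u = v"
  using One_terminal hom_Obj by blast

lemma ext_map:
  assumes "A \<in> Ty C \<Gamma>" "\<sigma> \<in> hom C \<Delta> \<Gamma>" "a \<in> Tm C \<Delta> (tysub C \<sigma> A)"
  shows ext_map_in: "ext_map C \<Gamma> A \<sigma> a \<in> hom C \<Delta> (Ext C \<Gamma> A)"
    and Proj_ext_map: "Proj C \<Gamma> A \<cdot> ext_map C \<Gamma> A \<sigma> a = \<sigma>"
    and Gen_ext_map: "tmsub C (ext_map C \<Gamma> A \<sigma> a) (tysub C (Proj C \<Gamma> A) A) (Gen C \<Gamma> A) = a"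
proof -
  have "\<exists>!u. u \<in> hom C \<Delta> (Ext C \<Gamma> A) \<and> Proj C \<Gamma> A \<cdot> u = \<sigma> \<and>
      tmsub C u (tysub C (Proj C \<Gamma> A) A) (Gen C \<Gamma> A) = a"
    using Ext_universal assms hom_Obj by blast
  from theI'[OF this] show "ext_map C \<Gamma> A \<sigma> a \<in> hom C \<Delta> (Ext C \<Gamma> A)"
    "Proj C \<Gamma> A \<cdot> ext_map C \<Gamma> A \<sigma> a = \<sigma>"
    "tmsub C (ext_map C \<Gamma> A \<sigma> a) (tysub C (Proj C \<Gamma> A) A) (Gen C \<Gamma> A) = a"
    unfolding ext_map_def hom_Dom[OF assms(2)] by auto
qed

lemma tmsub_Gen_in:
  assumes "A \<in> Ty C \<Gamma>" "\<Gamma> \<in> Obj C" "u \<in> hom C \<Delta> (Ext C \<Gamma> A)"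
  shows "tmsub C u (tysub C (Proj C \<Gamma> A) A) (Gen C \<Gamma> A) \<in> Tm C \<Delta> (tysub C (Proj C \<Gamma> A \<cdot> u) A)"
proof -
  have p: "Proj C \<Gamma> A \<in> hom C (Ext C \<Gamma> A) \<Gamma>" using assms Proj_in by blast
  show ?thesis
    unfolding tysub_Comp[OF assms(3) p assms(1)]
    by (rule tmsub_in[OF assms(3) tysub_in[OF p assms(1)] Gen_in[OF assms(2,1)]])
qed

text \<open>The uniqueness half of the universal property: the projection and the generic term are
  jointly monic.\<close>

lemma Ext_eqI:
  assumes "A \<in> Ty C \<Gamma>" "\<Gamma> \<in> Obj C" "u \<in> hom C \<Delta> (Ext C \<Gamma> A)" "v \<in> hom C \<Delta> (Ext C \<Gamma> A)"
    and "Proj C \<Gamma> A \<cdot> u = Proj C \<Gamma> A \<cdot> v"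
    and "tmsub C u (tysub C (Proj C \<Gamma> A) A) (Gen C \<Gamma> A) =
         tmsub C v (tysub C (Proj C \<Gamma> A) A) (Gen C \<Gamma> A)"
  shows "u = v"
proof -
  have "Proj C \<Gamma> A \<cdot> v \<in> hom C \<Delta> \<Gamma>" using assms Proj_in Comp_in by blast
  from Ext_universal[OF assms(2,1) this tmsub_Gen_in[OF assms(1,2,4)]] assms(3-6)
  show ?thesis by auto
qed

lemma ext_map_comp:
  assumes A: "A \<in> Ty C \<Gamma>" and \<sigma>: "\<sigma> \<in> hom C \<Delta> \<Gamma>" and a: "a \<in> Tm C \<Delta> (tysub C \<sigma> A)"
    and \<tau>: "\<tau> \<in> hom C \<Theta> \<Delta>"
  shows "ext_map C \<Gamma> A \<sigma> a \<cdot> \<tau> = ext_map C \<Gamma> A (\<sigma> \<cdot> \<tau>) (tmsub C \<tau> (tysub C \<sigma> A) a)"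
proof -
  note e = ext_map[OF A \<sigma> a]
  have \<Gamma>: "\<Gamma> \<in> Obj C" using \<sigma> hom_Obj by blast
  note p = Proj_in[OF \<Gamma> A]
  have "tmsub C \<tau> (tysub C \<sigma> A) a \<in> Tm C \<Theta> (tysub C (\<sigma> \<cdot> \<tau>) A)"
    unfolding tysub_Comp[OF \<tau> \<sigma> A] by (rule tmsub_in[OF \<tau> tysub_in[OF \<sigma> A] a])
  note e' = ext_map[OF A Comp_in[OF \<tau> \<sigma>] this]
  have ty: "tysub C (ext_map C \<Gamma> A \<sigma> a) (tysub C (Proj C \<Gamma> A) A) = tysub C \<sigma> A"
    using tysub_Comp[OF e(1) p A] e(2) by simp
  show ?thesis
  proof (rule Ext_eqI[OF A \<Gamma> Comp_in[OF \<tau> e(1)] e'(1)])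
    show "Proj C \<Gamma> A \<cdot> ext_map C \<Gamma> A \<sigma> a \<cdot> \<tau> =
      Proj C \<Gamma> A \<cdot> ext_map C \<Gamma> A (\<sigma> \<cdot> \<tau>) (tmsub C \<tau> (tysub C \<sigma> A) a)"
      using Comp_assoc[OF \<tau> e(1) p] e(2) e'(2) by simp
    show "tmsub C (ext_map C \<Gamma> A \<sigma> a \<cdot> \<tau>) (tysub C (Proj C \<Gamma> A) A) (Gen C \<Gamma> A) =
      tmsub C (ext_map C \<Gamma> A (\<sigma> \<cdot> \<tau>) (tmsub C \<tau> (tysub C \<sigma> A) a)) (tysub C (Proj C \<Gamma> A) A)
        (Gen C \<Gamma> A)"
      using tmsub_Comp[OF \<tau> e(1) tysub_in[OF p A] Gen_in[OF \<Gamma> A]] ty e(3) e'(3) by simp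
  qed
qed

end

lemma path_gen_relation:
  "path_append (path_gen g) (path_gen Sigma_gen) = path_append (path_gen g) (path_gen Tau_gen)"
  by transfer (use glob_rel.base[of "[]" _ "[]"] in simp)

section \<open>Boundary maps and spheres as pullbacks\<close>

context globular_cwf
begin

abbreviation "D n \<equiv> fob (Disk C) n"

abbreviation "S n \<equiv> Sph C n"

abbreviation "U n \<equiv> GTy C n (Ide C (S n))"

abbreviation "bd n g \<equiv> farr (Disk C) (n, path_gen g)"

lemma Disk:
  shows D_Obj: "D n \<in> Obj C"
    and Disk_in: "farr (Disk C) (n, p) \<in> hom C (D (n + path_length p)) (D n)"
    and Disk_nil: "farr (Disk C) (n, path_nil) = Ide C (D n)"
    and Disk_append: "farr (Disk C) (n, path_append p q) =
      farr (Disk C) (n, p) \<cdot> farr (Disk C) (n + path_length p, q)"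
  using Disk_functor by (simp_all add: is_functor_def)

lemma bd_in: "bd n g \<in> hom C (D (Suc n)) (D n)"
  using Disk_in[of n "path_gen g"] by simp

lemma bd_bd: "bd n g \<cdot> bd (Suc n) Sigma_gen = bd n g \<cdot> bd (Suc n) Tau_gen"
  using Disk_append[of n "path_gen g" "path_gen Sigma_gen"]
    Disk_append[of n "path_gen g" "path_gen Tau_gen"] path_gen_relation[of g] by simp

text \<open>The typing of \<open>tymap\<close> is a hypothesis because this fact is used inside the
  induction that establishes it.\<close>

lemma pullback_ex1:
  assumes "tymap C n \<in> hom C (D n) (S n)"
    and "x \<in> hom C X (D n)" "y \<in> hom C X (D n)" "tymap C n \<cdot> x = tymap C n \<cdot> y"
  shows "\<exists>!u. u \<in> hom C X (S (Suc n)) \<and> SphL C n \<cdot> u = x \<and> SphR C n \<cdot> u = y"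
proof -
  have "\<forall>X \<in> Obj C. \<forall>x \<in> hom C X (D n). \<forall>y \<in> hom C X (D n). tymap C n \<cdot> x = tymap C n \<cdot> y \<longrightarrow>
      (\<exists>!u. u \<in> hom C X (S (Suc n)) \<and> SphL C n \<cdot> u = x \<and> SphR C n \<cdot> u = y)"
    using Sph_Suc[of n] unfolding is_pullback_def hom_Dom[OF assms(1)] by (elim conjE)
  then show ?thesis using assms(2-4) hom_Obj(1)[OF assms(2)] by simp
qed

lemma tymap_Suc:
  assumes "tymap C n \<in> hom C (D n) (S n)"
    and "tymap C n \<cdot> bd n Sigma_gen = tymap C n \<cdot> bd n Tau_gen"
  shows "tymap C (Suc n) \<in> hom C (D (Suc n)) (S (Suc n)) \<and>
    SphL C n \<cdot> tymap C (Suc n) = bd n Sigma_gen \<and> SphR C n \<cdot> tymap C (Suc n) = bd n Tau_gen"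
  using theI'[OF pullback_ex1[OF assms(1) bd_in bd_in assms(2)]]
  by (simp add: glob_sigma_def glob_tau_def)

text \<open>The two claims need each other: the map into the next sphere exists only if source and
  target have equal boundary, and the globular identity one dimension up is checked through the
  components of that map.\<close>

lemma tymap_globular:
  "tymap C n \<in> hom C (D n) (S n) \<and> tymap C n \<cdot> bd n Sigma_gen = tymap C n \<cdot> bd n Tau_gen"
proof (induction n)
  case 0
  have t: "tymap C 0 \<in> hom C (D 0) (S 0)"
    using theI'[OF One_terminal[OF D_Obj[of 0]]] by (simp add: Sph_0)
  have "tymap C 0 \<cdot> bd 0 g \<in> hom C (D (Suc 0)) (One C)" for g
    using Comp_in[OF bd_in t] by (simp add: Sph_0)
  then show ?case using t to_One_unique by blast
next
  case (Suc n)
  note t = Suc[THEN conjunct1]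
  have T: "tymap C (Suc n) \<in> hom C (D (Suc n)) (S (Suc n))"
    "SphL C n \<cdot> tymap C (Suc n) = bd n Sigma_gen" "SphR C n \<cdot> tymap C (Suc n) = bd n Tau_gen"
    using tymap_Suc Suc by auto
  have L: "SphL C n \<in> hom C (S (Suc n)) (D n)" and R: "SphR C n \<in> hom C (S (Suc n)) (D n)"
    using Sph_Suc[of n] hom_Dom[OF t] unfolding is_pullback_def by auto
  have u: "tymap C (Suc n) \<cdot> bd (Suc n) g \<in> hom C (D (Suc (Suc n))) (S (Suc n))" for g
    using Comp_in[OF bd_in T(1)] .
  have lr: "SphL C n \<cdot> (tymap C (Suc n) \<cdot> bd (Suc n) g) = bd n Sigma_gen \<cdot> bd (Suc n) g"
    "SphR C n \<cdot> (tymap C (Suc n) \<cdot> bd (Suc n) g) = bd n Tau_gen \<cdot> bd (Suc n) g" for g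
    using Comp_assoc[OF bd_in T(1) L] Comp_assoc[OF bd_in T(1) R] T by simp_all
  \<comment> \<open>With this compatibility the pullback property applies, and \<open>bd_bd\<close>
    shows that both composites have the same components.\<close>
  have "tymap C n \<cdot> (bd n Sigma_gen \<cdot> bd (Suc n) Sigma_gen) =
    tymap C n \<cdot> (bd n Tau_gen \<cdot> bd (Suc n) Sigma_gen)"
    using Comp_assoc[OF bd_in bd_in t] Suc by metis
  from pullback_ex1[OF t Comp_in[OF bd_in bd_in] Comp_in[OF bd_in bd_in] this]
  have "tymap C (Suc n) \<cdot> bd (Suc n) Sigma_gen = tymap C (Suc n) \<cdot> bd (Suc n) Tau_gen"
    using u lr bd_bd[of n] by metis
  then show ?case using T by blast
qed

lemma tymap_in: "tymap C n \<in> hom C (D n) (S n)"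
  and SphL_tymap: "SphL C n \<cdot> tymap C (Suc n) = bd n Sigma_gen"
  and SphR_tymap: "SphR C n \<cdot> tymap C (Suc n) = bd n Tau_gen"
  using tymap_globular tymap_Suc by auto

lemma SphL_in: "SphL C n \<in> hom C (S (Suc n)) (D n)"
  and SphR_in: "SphR C n \<in> hom C (S (Suc n)) (D n)"
  and tymap_SphL: "tymap C n \<cdot> SphL C n = tymap C n \<cdot> SphR C n"
  using Sph_Suc[of n] hom_Dom[OF tymap_in] unfolding is_pullback_def by auto

lemma S_Obj: "S n \<in> Obj C"
  using tymap_in hom_Obj by blast

lemma U_in: "U n \<in> Ty C (S n)"
  by (rule GTy_in[OF Ide_in[OF S_Obj]])

text \<open>Yoneda: naturality makes \<open>GTy C n\<close> the substitution into the universal type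
  \<open>U n\<close>. This is what lets comprehension of \<open>U n\<close> classify terms of type
  \<open>GTy C n s\<close>.\<close>

lemma tysub_U: "s \<in> hom C X (S n) \<Longrightarrow> tysub C s (U n) = GTy C n s"
  using GTy_natural[OF _ Ide_in[OF S_Obj]] Ide_Comp by metis

definition pair :: "nat \<Rightarrow> 'm \<Rightarrow> 'm \<Rightarrow> 'm" where
  "pair n x y = (THE u. u \<in> hom C (Dom C x) (S (Suc n)) \<and> SphL C n \<cdot> u = x \<and> SphR C n \<cdot> u = y)"

lemma pair:
  assumes "x \<in> hom C X (D n)" "y \<in> hom C X (D n)" "tymap C n \<cdot> x = tymap C n \<cdot> y"
  shows pair_in: "pair n x y \<in> hom C X (S (Suc n))"
    and SphL_pair: "SphL C n \<cdot> pair n x y = x"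
    and SphR_pair: "SphR C n \<cdot> pair n x y = y"
  using theI'[OF pullback_ex1[OF tymap_in assms]] unfolding pair_def hom_Dom[OF assms(1)] by auto

lemma tymap_SphL_comp:
  assumes "u \<in> hom C X (S (Suc n))"
  shows "tymap C n \<cdot> (SphL C n \<cdot> u) = tymap C n \<cdot> (SphR C n \<cdot> u)"
  using Comp_assoc[OF assms SphL_in tymap_in] Comp_assoc[OF assms SphR_in tymap_in] tymap_SphL
  by simp

lemma sph_eqI:
  assumes "u \<in> hom C X (S (Suc n))" "v \<in> hom C X (S (Suc n))"
    and "SphL C n \<cdot> u = SphL C n \<cdot> v" "SphR C n \<cdot> u = SphR C n \<cdot> v"
  shows "u = v"
  using pullback_ex1[OF tymap_in Comp_in[OF assms(2) SphL_in] Comp_in[OF assms(2) SphR_in]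
      tymap_SphL_comp[OF assms(2)]] assms by blast

lemma pair_comp:
  assumes x: "x \<in> hom C X (D n)" "y \<in> hom C X (D n)" "tymap C n \<cdot> x = tymap C n \<cdot> y"
    and \<tau>: "\<tau> \<in> hom C Y X"
  shows "pair n x y \<cdot> \<tau> = pair n (x \<cdot> \<tau>) (y \<cdot> \<tau>)"
proof -
  note p = pair[OF x]
  have eq: "tymap C n \<cdot> (x \<cdot> \<tau>) = tymap C n \<cdot> (y \<cdot> \<tau>)"
    using Comp_assoc[OF \<tau> x(1) tymap_in] Comp_assoc[OF \<tau> x(2) tymap_in] x(3) by simp
  note q = pair[OF Comp_in[OF \<tau> x(1)] Comp_in[OF \<tau> x(2)] eq]
  show ?thesis
    using Comp_assoc[OF \<tau> p(1) SphL_in] Comp_assoc[OF \<tau> p(1) SphR_in] p q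
    by (intro sph_eqI[OF Comp_in[OF \<tau> p(1)] q(1)]) simp_all
qed

section \<open>Terms of type \<open>GTy C n s\<close> as maps into the disk with boundary
  \<open>s\<close>\<close>

definition disk_map :: "nat \<Rightarrow> 'm \<Rightarrow> 'e \<Rightarrow> 'm" where
  "disk_map n s a = DiskIso C n \<cdot> ext_map C (S n) (U n) s a"

definition DInv :: "nat \<Rightarrow> 'm" where
  "DInv n = (SOME g. g \<in> hom C (D n) (Ext C (S n) (U n)) \<and>
     g \<cdot> DiskIso C n = Ide C (Ext C (S n) (U n)) \<and> DiskIso C n \<cdot> g = Ide C (D n))"

lemma DInv:
  shows DInv_in: "DInv n \<in> hom C (D n) (Ext C (S n) (U n))"
    and DInv_DiskIso: "DInv n \<cdot> DiskIso C n = Ide C (Ext C (S n) (U n))"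
    and DiskIso_DInv: "DiskIso C n \<cdot> DInv n = Ide C (D n)"
proof -
  have "\<exists>g. g \<in> hom C (D n) (Ext C (S n) (U n)) \<and>
     g \<cdot> DiskIso C n = Ide C (Ext C (S n) (U n)) \<and> DiskIso C n \<cdot> g = Ide C (D n)"
    using DiskIso_iso[of n] DiskIso_in[of n] unfolding is_iso_def by (auto simp: hom_def)
  from someI_ex[OF this] show "DInv n \<in> hom C (D n) (Ext C (S n) (U n))"
    "DInv n \<cdot> DiskIso C n = Ide C (Ext C (S n) (U n))" "DiskIso C n \<cdot> DInv n = Ide C (D n)"
    unfolding DInv_def by auto
qed

definition disk_term :: "nat \<Rightarrow> 'm \<Rightarrow> 'e" where
  "disk_term n v = tmsub C (DInv n \<cdot> v) (tysub C (Proj C (S n) (U n)) (U n)) (Gen C (S n) (U n))"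

lemma Proj_DInv: "v \<in> hom C X (D n) \<Longrightarrow> Proj C (S n) (U n) \<cdot> (DInv n \<cdot> v) = tymap C n \<cdot> v"
  using Comp_assoc[OF Comp_in[OF _ DInv_in] DiskIso_in tymap_in, of v X n]
    Comp_assoc[OF _ DInv_in DiskIso_in, of v X n] DiskIso_over[of n] DiskIso_DInv[of n] Ide_Comp
  by metis

lemma disk_map_ext:
  assumes "s \<in> hom C X (S n)" "a \<in> Tm C X (GTy C n s)"
  shows "ext_map C (S n) (U n) s a \<in> hom C X (Ext C (S n) (U n))"
    "Proj C (S n) (U n) \<cdot> ext_map C (S n) (U n) s a = s"
    "tmsub C (ext_map C (S n) (U n) s a) (tysub C (Proj C (S n) (U n)) (U n))
       (Gen C (S n) (U n)) = a"
  using ext_map[OF U_in assms(1)] assms(2) unfolding tysub_U[OF assms(1)] by auto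

lemma disk_map_in:
  assumes "s \<in> hom C X (S n)" "a \<in> Tm C X (GTy C n s)"
  shows "disk_map n s a \<in> hom C X (D n)"
  unfolding disk_map_def using Comp_in[OF disk_map_ext(1)[OF assms] DiskIso_in] .

lemma tymap_disk_map:
  assumes "s \<in> hom C X (S n)" "a \<in> Tm C X (GTy C n s)"
  shows "tymap C n \<cdot> disk_map n s a = s"
  unfolding disk_map_def
  using Comp_assoc[OF disk_map_ext(1)[OF assms] DiskIso_in tymap_in] DiskIso_over[of n]
    disk_map_ext(2)[OF assms] by simp

lemma disk_map_comp:
  assumes s: "s \<in> hom C X (S n)" and a: "a \<in> Tm C X (GTy C n s)" and \<tau>: "\<tau> \<in> hom C Y X"
  shows "disk_map n s a \<cdot> \<tau> = disk_map n (s \<cdot> \<tau>) (tmsub C \<tau> (GTy C n s) a)"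
  unfolding disk_map_def
  using Comp_assoc[OF \<tau> disk_map_ext(1)[OF s a] DiskIso_in]
    ext_map_comp[OF U_in s _ \<tau>, of a] a tysub_U[OF s] by simp

lemma disk_term_in:
  assumes "v \<in> hom C X (D n)"
  shows "disk_term n v \<in> Tm C X (GTy C n (tymap C n \<cdot> v))"
  using tmsub_Gen_in[OF U_in S_Obj Comp_in[OF assms DInv_in]]
  unfolding disk_term_def Proj_DInv[OF assms] tysub_U[OF Comp_in[OF assms tymap_in]] .

lemma disk_term_disk_map:
  assumes "s \<in> hom C X (S n)" "a \<in> Tm C X (GTy C n s)"
  shows "disk_term n (disk_map n s a) = a"
proof -
  note e = disk_map_ext[OF assms]
  have "DInv n \<cdot> (DiskIso C n \<cdot> ext_map C (S n) (U n) s a) = ext_map C (S n) (U n) s a"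
    using Comp_assoc[OF e(1) DiskIso_in DInv_in] DInv_DiskIso Ide_Comp[OF e(1)] by simp
  then show ?thesis unfolding disk_term_def disk_map_def using e(3) by simp
qed

lemma disk_map_disk_term:
  assumes v: "v \<in> hom C X (D n)"
  shows "disk_map n (tymap C n \<cdot> v) (disk_term n v) = v"
proof -
  note e = disk_map_ext[OF Comp_in[OF v tymap_in] disk_term_in[OF v]]
  have "ext_map C (S n) (U n) (tymap C n \<cdot> v) (disk_term n v) = DInv n \<cdot> v"
    using e Proj_DInv[OF v]
    by (intro Ext_eqI[OF U_in S_Obj e(1) Comp_in[OF v DInv_in]]) (simp_all add: disk_term_def)
  then show ?thesis unfolding disk_map_def
    using Comp_assoc[OF v DInv_in DiskIso_in] DiskIso_DInv Ide_Comp[OF v] by simp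
qed

text \<open>Naturality of \<open>disk_map\<close> carried over to its inverse: write
  \<open>v\<close> as a disk map, precompose, and recover the term.\<close>

lemma disk_term_comp:
  assumes v: "v \<in> hom C X (D n)" and \<tau>: "\<tau> \<in> hom C Y X"
  shows "disk_term n (v \<cdot> \<tau>) = tmsub C \<tau> (GTy C n (tymap C n \<cdot> v)) (disk_term n v)"
proof -
  have s: "tymap C n \<cdot> v \<in> hom C X (S n)" using Comp_in[OF v tymap_in] .
  have "tmsub C \<tau> (GTy C n (tymap C n \<cdot> v)) (disk_term n v) \<in>
      Tm C Y (GTy C n (tymap C n \<cdot> v \<cdot> \<tau>))"
    using tmsub_in[OF \<tau> GTy_in[OF s] disk_term_in[OF v]] GTy_natural[OF \<tau> s] Comp_assoc[OF \<tau> v tymap_in]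
    by simp
  then show ?thesis
    using disk_term_disk_map[of "tymap C n \<cdot> v \<cdot> \<tau>" Y n] disk_map_comp[OF s disk_term_in[OF v] \<tau>]
      disk_map_disk_term[OF v] Comp_assoc[OF \<tau> v tymap_in] Comp_in[OF \<tau> s] by metis
qed

end

section \<open>The interpretation of contexts\<close>

primrec tm_idx :: "gtm \<Rightarrow> nat" where
  "tm_idx (Var i) = i"

primrec ty_dim :: "gty \<Rightarrow> nat" where
  "ty_dim Star = 0"
| "ty_dim (Arrow A t u) = Suc (ty_dim A)"

lemma ty_dim_subst [simp]: "ty_dim (subst_ty \<gamma> A) = ty_dim A"
  by (induction A) auto

lemma ty_dim_U_ty [simp]: "ty_dim (U_ty n) = n"
  by (induction n) auto

context globular_cwf
begin

text \<open>Here \<open>vs\<close> lists maps from \<open>X\<close> into disks, one for each variable, and \<open>sph_of X vs A\<close> is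
  the boundary that \<open>vs\<close> assigns to the type \<open>A\<close>.\<close>

primrec sph_of :: "'o \<Rightarrow> 'm list \<Rightarrow> gty \<Rightarrow> 'm" where
  "sph_of X vs Star = (THE u. u \<in> hom C X (S 0))"
| "sph_of X vs (Arrow A t u) = pair (ty_dim A) (vs ! tm_idx t) (vs ! tm_idx u)"

text \<open>Boundaries are computed from the whole family instead of a prefix, which keeps the
  condition pointwise; \<open>realizes_snoc\<close> recovers the step-by-step form.\<close>

definition realizes :: "'o \<Rightarrow> 'm list \<Rightarrow> gctx \<Rightarrow> bool" where
  "realizes X vs \<Gamma> \<longleftrightarrow> X \<in> Obj C \<and> length vs = length \<Gamma> \<and>
     (\<forall>i<length \<Gamma>. vs ! i \<in> hom C X (D (ty_dim (\<Gamma> ! i))) \<and>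
        tymap C (ty_dim (\<Gamma> ! i)) \<cdot> (vs ! i) = sph_of X vs (\<Gamma> ! i))"

lemma realizes_length: "realizes X vs \<Gamma> \<Longrightarrow> length vs = length \<Gamma>"
  by (simp add: realizes_def)

lemma realizes_tm:
  assumes "realizes X vs \<Gamma>" "wf_tm \<Gamma> t A"
  shows "vs ! tm_idx t \<in> hom C X (D (ty_dim A))"
    "tymap C (ty_dim A) \<cdot> (vs ! tm_idx t) = sph_of X vs A"
  using assms by (auto simp: wf_tm_iff realizes_def)

lemma to_S0: "X \<in> Obj C \<Longrightarrow> (THE u. u \<in> hom C X (S 0)) \<in> hom C X (S 0)"
  using theI'[OF One_terminal] by (simp add: Sph_0)

lemma to_S0_unique: "\<lbrakk>u \<in> hom C X (S 0); v \<in> hom C X (S 0)\<rbrakk> \<Longrightarrow> u = v"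
  using to_One_unique by (simp add: Sph_0)

text \<open>\<open>pair\<close> needs endpoints with equal boundary, and in a realization both
  endpoints have the boundary of the base type. No induction on \<open>A\<close> is
  required.\<close>

lemma sph_of_in:
  assumes "realizes X vs \<Gamma>" "wf_ty \<Gamma> A"
  shows "sph_of X vs A \<in> hom C X (S (ty_dim A))"
proof (cases A)
  case Star
  then show ?thesis using assms to_S0 by (simp add: realizes_def)
next
  case (Arrow B t u)
  then show ?thesis
    using assms realizes_tm[OF assms(1), of _ B] by (auto intro!: pair_in)
qed

lemma sph_of_comp:
  assumes r: "realizes X vs \<Gamma>" and A: "wf_ty \<Gamma> A" and \<tau>: "\<tau> \<in> hom C Y X"
  shows "sph_of Y (map (\<lambda>v. v \<cdot> \<tau>) vs) A = sph_of X vs A \<cdot> \<tau>"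
proof (cases A)
  case Star
  then have "sph_of X vs A \<cdot> \<tau> \<in> hom C Y (S 0)"
    using sph_of_in[OF r A] \<tau> Comp_in by simp
  then show ?thesis
    using to_S0_unique[OF to_S0[OF hom_Obj(1)[OF \<tau>]]] Star by simp
next
  case (Arrow B t u)
  then have "tm_idx t < length vs" "tm_idx u < length vs"
    using A realizes_length[OF r] by (auto simp: wf_tm_iff)
  then show ?thesis
    using Arrow A realizes_tm[OF r, of _ B] by (simp add: pair_comp[OF _ _ _ \<tau>])
qed

lemma realizes_comp:
  assumes r: "realizes X vs \<Gamma>" and \<Gamma>: "wf_ctx \<Gamma>" and \<tau>: "\<tau> \<in> hom C Y X"
  shows "realizes Y (map (\<lambda>v. v \<cdot> \<tau>) vs) \<Gamma>"
  unfolding realizes_def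
proof (intro conjI allI impI)
  fix i assume i: "i < length \<Gamma>"
  then have A: "wf_ty \<Gamma> (\<Gamma> ! i)" and v: "vs ! i \<in> hom C X (D (ty_dim (\<Gamma> ! i)))"
    and t: "tymap C (ty_dim (\<Gamma> ! i)) \<cdot> (vs ! i) = sph_of X vs (\<Gamma> ! i)" and l: "i < length vs"
    using r \<Gamma> by (auto simp: realizes_def wf_ctx_nth)
  show "map (\<lambda>v. v \<cdot> \<tau>) vs ! i \<in> hom C Y (D (ty_dim (\<Gamma> ! i)))"
    using Comp_in[OF \<tau> v] l by simp
  show "tymap C (ty_dim (\<Gamma> ! i)) \<cdot> (map (\<lambda>v. v \<cdot> \<tau>) vs ! i) =
      sph_of Y (map (\<lambda>v. v \<cdot> \<tau>) vs) (\<Gamma> ! i)"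
    using sph_of_comp[OF r A \<tau>] Comp_assoc[OF \<tau> v tymap_in] l t by simp
qed (use r hom_Obj(1)[OF \<tau>] in \<open>auto simp: realizes_def\<close>)

text \<open>Terms are variables, so a substitution acts on a family merely by reindexing it.\<close>

lemma sph_of_subst:
  assumes "wf_ty \<Gamma> A" "length \<gamma> = length \<Gamma>"
  shows "sph_of X (map (\<lambda>t. vs ! tm_idx t) \<gamma>) A = sph_of X vs (subst_ty \<gamma> A)"
  using assms by (cases A) (auto simp: wf_tm_iff)

lemma realizes_subst:
  assumes "realizes X vs \<Delta>" "wf_sub \<Delta> \<gamma> \<Gamma>"
  shows "realizes X (map (\<lambda>t. vs ! tm_idx t) \<gamma>) \<Gamma>"
proof -
  have l: "length \<gamma> = length \<Gamma>" and \<Gamma>: "wf_ctx \<Gamma>"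
    and tm: "\<And>i. i < length \<Gamma> \<Longrightarrow> wf_tm \<Delta> (\<gamma> ! i) (subst_ty \<gamma> (\<Gamma> ! i))"
    using assms(2) by (auto simp: wf_sub_iff)
  show ?thesis
    using realizes_tm[OF assms(1) tm] assms(1) l
    by (simp add: realizes_def sph_of_subst[OF wf_ctx_nth[OF \<Gamma>]])
qed

lemma sph_of_append:
  assumes "wf_ty \<Gamma> A" "length vs = length \<Gamma>"
  shows "sph_of X (vs @ ws) A = sph_of X vs A"
  using assms by (cases A) (auto simp: wf_tm_iff nth_append)

lemma realizes_snoc:
  assumes "wf_ty \<Gamma> A"
  shows "realizes X (vs @ [v]) (\<Gamma> @ [A]) \<longleftrightarrow>
    realizes X vs \<Gamma> \<and> v \<in> hom C X (D (ty_dim A)) \<and> tymap C (ty_dim A) \<cdot> v = sph_of X vs A"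
proof (cases "length vs = length \<Gamma>")
  case True
  have "sph_of X (vs @ [v]) (\<Gamma> ! i) = sph_of X vs (\<Gamma> ! i)" if "i < length \<Gamma>" for i
    using sph_of_append[OF wf_ctx_nth[OF wf_ty_wf_ctx[OF assms] that] True] .
  then show ?thesis
    using True sph_of_append[OF assms True, of X "[v]"]
    by (auto simp: realizes_def less_Suc_eq nth_append)
qed (auto simp: realizes_def)

lemma realizes_snocE:
  assumes "realizes X ws (\<Gamma> @ [A])" "wf_ty \<Gamma> A"
  obtains vs v where "ws = vs @ [v]" "realizes X vs \<Gamma>" "v \<in> hom C X (D (ty_dim A))"
    "tymap C (ty_dim A) \<cdot> v = sph_of X vs A"
proof (cases ws rule: rev_cases)
  case Nil
  then show ?thesis using assms by (simp add: realizes_def)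
next
  case (snoc vs v)
  then show ?thesis using that assms realizes_snoc by blast
qed

text \<open>Contexts grow at the end, so the recursion runs over the reversed list.\<close>

primrec interp_rev :: "gctx \<Rightarrow> 'o \<times> 'm list" where
  "interp_rev [] = (One C, [])"
| "interp_rev (A # \<Gamma>) =
    (let (X, vs) = interp_rev \<Gamma>; s = sph_of X vs A; T = GTy C (ty_dim A) s; p = Proj C X T
     in (Ext C X T, map (\<lambda>v. v \<cdot> p) vs @ [disk_map (ty_dim A) (s \<cdot> p) (Gen C X T)]))"

definition iobj :: "gctx \<Rightarrow> 'o" where
  "iobj \<Gamma> = fst (interp_rev (rev \<Gamma>))"

definition ivars :: "gctx \<Rightarrow> 'm list" where
  "ivars \<Gamma> = snd (interp_rev (rev \<Gamma>))"

definition isph :: "gctx \<Rightarrow> gty \<Rightarrow> 'm" where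
  "isph \<Gamma> A = sph_of (iobj \<Gamma>) (ivars \<Gamma>) A"

definition ity :: "gctx \<Rightarrow> gty \<Rightarrow> 't" where
  "ity \<Gamma> A = GTy C (ty_dim A) (isph \<Gamma> A)"

abbreviation iproj :: "gctx \<Rightarrow> gty \<Rightarrow> 'm" where
  "iproj \<Gamma> A \<equiv> Proj C (iobj \<Gamma>) (ity \<Gamma> A)"

definition ilast :: "gctx \<Rightarrow> gty \<Rightarrow> 'm" where
  "ilast \<Gamma> A = disk_map (ty_dim A) (isph \<Gamma> A \<cdot> iproj \<Gamma> A) (Gen C (iobj \<Gamma>) (ity \<Gamma> A))"

lemma iobj_Nil [simp]: "iobj [] = One C"
  by (simp add: iobj_def)

lemma ivars_Nil [simp]: "ivars [] = []"
  by (simp add: ivars_def)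

lemma iobj_snoc [simp]: "iobj (\<Gamma> @ [A]) = Ext C (iobj \<Gamma>) (ity \<Gamma> A)"
  by (simp add: iobj_def ity_def isph_def ivars_def Let_def split_beta)

lemma ivars_snoc [simp]:
  "ivars (\<Gamma> @ [A]) = map (\<lambda>v. v \<cdot> iproj \<Gamma> A) (ivars \<Gamma>) @ [ilast \<Gamma> A]"
  by (simp add: iobj_def ity_def isph_def ivars_def ilast_def Let_def split_beta)

text \<open>Realization is assumed rather than obtained from \<open>wf_ctx\<close>, since these
  facts serve the inductive step of \<open>interp_realizes\<close>.\<close>

lemma ext_interp:
  assumes r: "realizes (iobj \<Gamma>) (ivars \<Gamma>) \<Gamma>" and A: "wf_ty \<Gamma> A"
  shows ity_in: "ity \<Gamma> A \<in> Ty C (iobj \<Gamma>)"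
    and iproj_in: "iproj \<Gamma> A \<in> hom C (Ext C (iobj \<Gamma>) (ity \<Gamma> A)) (iobj \<Gamma>)"
    and isph_iproj_in:
      "isph \<Gamma> A \<cdot> iproj \<Gamma> A \<in> hom C (Ext C (iobj \<Gamma>) (ity \<Gamma> A)) (S (ty_dim A))"
    and GTy_isph_iproj:
      "GTy C (ty_dim A) (isph \<Gamma> A \<cdot> iproj \<Gamma> A) = tysub C (iproj \<Gamma> A) (ity \<Gamma> A)"
    and Gen_ity_in: "Gen C (iobj \<Gamma>) (ity \<Gamma> A) \<in>
      Tm C (Ext C (iobj \<Gamma>) (ity \<Gamma> A)) (GTy C (ty_dim A) (isph \<Gamma> A \<cdot> iproj \<Gamma> A))"
proof -
  have X: "iobj \<Gamma> \<in> Obj C" using r by (simp add: realizes_def)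
  have s: "isph \<Gamma> A \<in> hom C (iobj \<Gamma>) (S (ty_dim A))"
    using sph_of_in[OF r A] by (simp add: isph_def)
  show T: "ity \<Gamma> A \<in> Ty C (iobj \<Gamma>)" unfolding ity_def by (rule GTy_in[OF s])
  show p: "iproj \<Gamma> A \<in> hom C (Ext C (iobj \<Gamma>) (ity \<Gamma> A)) (iobj \<Gamma>)" by (rule Proj_in[OF X T])
  show "isph \<Gamma> A \<cdot> iproj \<Gamma> A \<in> hom C (Ext C (iobj \<Gamma>) (ity \<Gamma> A)) (S (ty_dim A))"
    by (rule Comp_in[OF p s])
  show e: "GTy C (ty_dim A) (isph \<Gamma> A \<cdot> iproj \<Gamma> A) = tysub C (iproj \<Gamma> A) (ity \<Gamma> A)"
    using GTy_natural[OF p s] by (simp add: ity_def)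
  show "Gen C (iobj \<Gamma>) (ity \<Gamma> A) \<in>
      Tm C (Ext C (iobj \<Gamma>) (ity \<Gamma> A)) (GTy C (ty_dim A) (isph \<Gamma> A \<cdot> iproj \<Gamma> A))"
    unfolding e by (rule Gen_in[OF X T])
qed

lemma interp_realizes: "wf_ctx \<Gamma> \<Longrightarrow> realizes (iobj \<Gamma>) (ivars \<Gamma>) \<Gamma>"
proof (induction \<Gamma> rule: rev_induct)
  case Nil
  show ?case by (simp add: realizes_def One_in)
next
  case (snoc A \<Gamma>)
  then have A: "wf_ty \<Gamma> A" and \<Gamma>: "wf_ctx \<Gamma>" by (auto dest: wf_ty_wf_ctx)
  have r: "realizes (iobj \<Gamma>) (ivars \<Gamma>) \<Gamma>" using snoc.IH \<Gamma> by blast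
  note e = ext_interp[OF r A]
  show ?case
    using realizes_comp[OF r \<Gamma> e(2)] sph_of_comp[OF r A e(2)] disk_map_in[OF e(3,5)]
      tymap_disk_map[OF e(3,5)]
    by (simp add: realizes_snoc[OF A] ilast_def isph_def)
qed

lemma isph_in: "wf_ty \<Gamma> A \<Longrightarrow> isph \<Gamma> A \<in> hom C (iobj \<Gamma>) (S (ty_dim A))"
  unfolding isph_def by (rule sph_of_in[OF interp_realizes[OF wf_ty_wf_ctx]])

text \<open>A map into a comprehension consists of a map to the base and a term. This relates the
  term component to the value on the newest variable, which is the link needed in
  \<open>interp_universal\<close>.\<close>

lemma ilast_comp:
  assumes A: "wf_ty \<Gamma> A" and u: "u \<in> hom C Y (iobj (\<Gamma> @ [A]))"
  shows "ilast \<Gamma> A \<cdot> u = disk_map (ty_dim A) (isph \<Gamma> A \<cdot> (iproj \<Gamma> A \<cdot> u))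
    (tmsub C u (tysub C (iproj \<Gamma> A) (ity \<Gamma> A)) (Gen C (iobj \<Gamma>) (ity \<Gamma> A)))"
proof -
  note e = ext_interp[OF interp_realizes[OF wf_ty_wf_ctx[OF A]] A]
  show ?thesis
    using disk_map_comp[OF e(3,5), of u Y] u e(4) Comp_assoc[OF _ e(2) isph_in[OF A], of u Y]
    by (simp add: ilast_def)
qed

lemma map_comp_assoc:
  assumes r: "realizes X vs \<Gamma>" and p: "p \<in> hom C Y X" and u: "u \<in> hom C Z Y"
  shows "map (\<lambda>v. v \<cdot> u) (map (\<lambda>v. v \<cdot> p) vs) = map (\<lambda>v. v \<cdot> (p \<cdot> u)) vs"
proof (rule nth_equalityI)
  fix i assume "i < length (map (\<lambda>v. v \<cdot> u) (map (\<lambda>v. v \<cdot> p) vs))"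
  moreover from this have "vs ! i \<in> hom C X (D (ty_dim (\<Gamma> ! i)))"
    using r by (simp add: realizes_def)
  ultimately show "map (\<lambda>v. v \<cdot> u) (map (\<lambda>v. v \<cdot> p) vs) ! i = map (\<lambda>v. v \<cdot> (p \<cdot> u)) vs ! i"
    using Comp_assoc[OF u p] by simp
qed simp

text \<open>In the inductive step the map to the shorter context is forced by all entries but the
  last, and the remaining term is forced because terms with a given boundary correspond bijectively
  to maps into the disk.\<close>

lemma interp_universal:
  "\<lbrakk>wf_ctx \<Gamma>; realizes Y ws \<Gamma>\<rbrakk>
    \<Longrightarrow> \<exists>!u. u \<in> hom C Y (iobj \<Gamma>) \<and> map (\<lambda>v. v \<cdot> u) (ivars \<Gamma>) = ws"
proof (induction \<Gamma> arbitrary: ws rule: rev_induct)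
  case Nil
  then show ?case using One_terminal by (simp add: realizes_def)
next
  case (snoc A \<Gamma>)
  then have A: "wf_ty \<Gamma> A" and \<Gamma>: "wf_ctx \<Gamma>" by (auto dest: wf_ty_wf_ctx)
  note r = interp_realizes[OF \<Gamma>]
  note e = ext_interp[OF r A]
  have X: "iobj \<Gamma> \<in> Obj C" using r by (simp add: realizes_def)
  let ?n = "ty_dim A" and ?T = "ity \<Gamma> A"
  obtain ws' w where ws: "ws = ws' @ [w]" "realizes Y ws' \<Gamma>" "w \<in> hom C Y (D ?n)"
    "tymap C ?n \<cdot> w = sph_of Y ws' A"
    using realizes_snocE[OF snoc.prems(2) A] .
  obtain u' where u': "u' \<in> hom C Y (iobj \<Gamma>)" "map (\<lambda>v. v \<cdot> u') (ivars \<Gamma>) = ws'"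
    and u'_unique: "\<And>u. \<lbrakk>u \<in> hom C Y (iobj \<Gamma>); map (\<lambda>v. v \<cdot> u) (ivars \<Gamma>) = ws'\<rbrakk> \<Longrightarrow> u = u'"
    using snoc.IH[OF \<Gamma> ws(2)] by blast
  have s: "sph_of Y ws' A = isph \<Gamma> A \<cdot> u'"
    using sph_of_comp[OF r A u'(1)] u'(2) by (simp add: isph_def)
  have su: "isph \<Gamma> A \<cdot> u' \<in> hom C Y (S ?n)" by (rule Comp_in[OF u'(1) isph_in[OF A]])
  have Tu: "tysub C u' ?T = GTy C ?n (isph \<Gamma> A \<cdot> u')"
    using GTy_natural[OF u'(1) isph_in[OF A]] by (simp add: ity_def)
  \<comment> \<open>The one term whose disk map, over the boundary of \<open>w\<close>, is
    \<open>w\<close> itself.\<close>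
  let ?a = "disk_term ?n w"
  have a: "?a \<in> Tm C Y (tysub C u' ?T)"
    using disk_term_in[OF ws(3)] ws(4) s Tu by simp
  note x = ext_map[OF e(1) u'(1) a]
  show ?case
  proof (rule ex1I[of _ "ext_map C (iobj \<Gamma>) ?T u' ?a"])
    have "ilast \<Gamma> A \<cdot> ext_map C (iobj \<Gamma>) ?T u' ?a = w"
      using ilast_comp[OF A, of _ Y] x disk_map_disk_term[OF ws(3)] ws(4) s by simp
    then show "ext_map C (iobj \<Gamma>) ?T u' ?a \<in> hom C Y (iobj (\<Gamma> @ [A])) \<and>
        map (\<lambda>v. v \<cdot> ext_map C (iobj \<Gamma>) ?T u' ?a) (ivars (\<Gamma> @ [A])) = ws"
      using x map_comp_assoc[OF r e(2) x(1)] u'(2) ws(1) by (simp del: map_map)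
  next
    fix u assume u: "u \<in> hom C Y (iobj (\<Gamma> @ [A])) \<and> map (\<lambda>v. v \<cdot> u) (ivars (\<Gamma> @ [A])) = ws"
    then have uh: "u \<in> hom C Y (Ext C (iobj \<Gamma>) ?T)" by simp
    have "map (\<lambda>v. v \<cdot> (iproj \<Gamma> A \<cdot> u)) (ivars \<Gamma>) = ws'" and w: "ilast \<Gamma> A \<cdot> u = w"
      using u ws(1) map_comp_assoc[OF r e(2) uh] by (simp_all del: map_map)
    then have pu: "iproj \<Gamma> A \<cdot> u = u'" using u'_unique Comp_in[OF uh e(2)] by blast
    let ?b = "tmsub C u (tysub C (iproj \<Gamma> A) ?T) (Gen C (iobj \<Gamma>) ?T)"
    have "?b \<in> Tm C Y (GTy C ?n (isph \<Gamma> A \<cdot> u'))"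
      using tmsub_Gen_in[OF e(1) X uh] pu Tu by simp
    \<comment> \<open>\<open>disk_term\<close> is a left inverse of \<open>disk_map\<close>, so the
      value \<open>w\<close> on the last variable determines the term.\<close>
    then have "?b = ?a"
      using disk_term_disk_map[OF su] ilast_comp[OF A, of u Y] u pu w by simp
    then show "u = ext_map C (iobj \<Gamma>) ?T u' ?a"
      using pu x by (intro Ext_eqI[OF e(1) X uh x(1)]) simp_all
  qed
qed

section \<open>Interpretation of substitutions, types and terms\<close>

definition isub :: "gmor \<Rightarrow> 'm" where
  "isub = (\<lambda>(\<Delta>, \<gamma>, \<Gamma>). THE u. u \<in> hom C (iobj \<Delta>) (iobj \<Gamma>) \<and>
     map (\<lambda>v. v \<cdot> u) (ivars \<Gamma>) = map (\<lambda>t. ivars \<Delta> ! tm_idx t) \<gamma>)"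

lemma isub:
  assumes "wf_sub \<Delta> \<gamma> \<Gamma>"
  shows isub_in: "isub (\<Delta>, \<gamma>, \<Gamma>) \<in> hom C (iobj \<Delta>) (iobj \<Gamma>)"
    and ivars_isub: "map (\<lambda>v. v \<cdot> isub (\<Delta>, \<gamma>, \<Gamma>)) (ivars \<Gamma>) = map (\<lambda>t. ivars \<Delta> ! tm_idx t) \<gamma>"
    and isub_unique: "\<And>u. \<lbrakk>u \<in> hom C (iobj \<Delta>) (iobj \<Gamma>);
      map (\<lambda>v. v \<cdot> u) (ivars \<Gamma>) = map (\<lambda>t. ivars \<Delta> ! tm_idx t) \<gamma>\<rbrakk> \<Longrightarrow> isub (\<Delta>, \<gamma>, \<Gamma>) = u"
proof -
  have wf: "wf_ctx \<Delta>" "wf_ctx \<Gamma>" using assms by (auto simp: wf_sub_iff)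
  note ex1 = interp_universal[OF wf(2) realizes_subst[OF interp_realizes[OF wf(1)] assms]]
  show "isub (\<Delta>, \<gamma>, \<Gamma>) \<in> hom C (iobj \<Delta>) (iobj \<Gamma>)"
    "map (\<lambda>v. v \<cdot> isub (\<Delta>, \<gamma>, \<Gamma>)) (ivars \<Gamma>) = map (\<lambda>t. ivars \<Delta> ! tm_idx t) \<gamma>"
    using theI'[OF ex1] unfolding isub_def by auto
  show "isub (\<Delta>, \<gamma>, \<Gamma>) = u" if "u \<in> hom C (iobj \<Delta>) (iobj \<Gamma>)"
      "map (\<lambda>v. v \<cdot> u) (ivars \<Gamma>) = map (\<lambda>t. ivars \<Delta> ! tm_idx t) \<gamma>" for u
    unfolding isub_def prod.case using ex1 that by (intro the1_equality) auto
qed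

lemma length_ivars: "wf_ctx \<Gamma> \<Longrightarrow> length (ivars \<Gamma>) = length \<Gamma>"
  using interp_realizes by (simp add: realizes_def)

lemma ivars_nth_isub:
  assumes "wf_sub \<Delta> \<gamma> \<Gamma>" "i < length \<Gamma>"
  shows "ivars \<Gamma> ! i \<cdot> isub (\<Delta>, \<gamma>, \<Gamma>) = ivars \<Delta> ! tm_idx (\<gamma> ! i)"
proof -
  have l: "length (ivars \<Gamma>) = length \<Gamma>" "length \<gamma> = length \<Gamma>"
    using length_ivars assms by (auto simp: wf_sub_iff)
  have "map (\<lambda>v. v \<cdot> isub (\<Delta>, \<gamma>, \<Gamma>)) (ivars \<Gamma>) ! i = map (\<lambda>t. ivars \<Delta> ! tm_idx t) \<gamma> ! i"
    using ivars_isub[OF assms(1)] by simp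
  then show ?thesis using l assms(2) by simp
qed

text \<open>The uniqueness half of \<open>interp_universal\<close> in pointwise form. Identities,
  composites and projections are all handled by testing a candidate on variables.\<close>

lemma isub_eqI:
  assumes \<gamma>: "wf_sub \<Delta> \<gamma> \<Gamma>" and u: "u \<in> hom C (iobj \<Delta>) (iobj \<Gamma>)"
    and eq: "\<And>i. i < length \<Gamma> \<Longrightarrow> ivars \<Gamma> ! i \<cdot> u = ivars \<Delta> ! tm_idx (\<gamma> ! i)"
  shows "isub (\<Delta>, \<gamma>, \<Gamma>) = u"
proof (rule isub_unique[OF \<gamma> u], rule nth_equalityI)
qed (use assms length_ivars in \<open>auto simp: wf_sub_iff\<close>)

lemma ivars_tm:
  assumes "wf_tm \<Gamma> t A"
  shows "ivars \<Gamma> ! tm_idx t \<in> hom C (iobj \<Gamma>) (D (ty_dim A))"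
    and "tymap C (ty_dim A) \<cdot> (ivars \<Gamma> ! tm_idx t) = isph \<Gamma> A"
  using realizes_tm[OF interp_realizes assms] assms by (auto simp: wf_tm_iff isph_def)

lemma ivars_nth_in:
  "\<lbrakk>wf_ctx \<Gamma>; i < length \<Gamma>\<rbrakk> \<Longrightarrow> ivars \<Gamma> ! i \<in> hom C (iobj \<Gamma>) (D (ty_dim (\<Gamma> ! i)))"
  using ivars_tm(1)[OF tm_var] by simp

lemma ivars_tm_isub:
  assumes "wf_sub \<Delta> \<gamma> \<Gamma>" "wf_tm \<Gamma> t A"
  shows "ivars \<Gamma> ! tm_idx t \<cdot> isub (\<Delta>, \<gamma>, \<Gamma>) = ivars \<Delta> ! tm_idx (subst_tm \<gamma> t)"
  using ivars_nth_isub[OF assms(1)] assms(2) by (auto simp: wf_tm_iff)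

lemma isub_id:
  assumes "wf_ctx \<Gamma>"
  shows "isub (\<Gamma>, subst_id (length \<Gamma>), \<Gamma>) = Ide C (iobj \<Gamma>)"
proof (rule isub_eqI[OF wf_sub_id[OF assms]])
  have "iobj \<Gamma> \<in> Obj C" using interp_realizes[OF assms] by (simp add: realizes_def)
  then show "Ide C (iobj \<Gamma>) \<in> hom C (iobj \<Gamma>) (iobj \<Gamma>)" by (rule Ide_in)
qed (simp add: Comp_Ide[OF ivars_nth_in[OF assms]])

lemma isub_comp:
  assumes \<delta>: "wf_sub \<Theta> \<delta> \<Delta>" and \<gamma>: "wf_sub \<Delta> \<gamma> \<Gamma>"
  shows "isub (\<Theta>, subst_comp \<gamma> \<delta>, \<Gamma>) = isub (\<Delta>, \<gamma>, \<Gamma>) \<cdot> isub (\<Theta>, \<delta>, \<Delta>)"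
proof (rule isub_eqI[OF wf_sub_comp[OF \<delta> \<gamma>] Comp_in[OF isub_in[OF \<delta>] isub_in[OF \<gamma>]]])
  fix i assume i: "i < length \<Gamma>"
  have \<Gamma>: "wf_ctx \<Gamma>" "length \<gamma> = length \<Gamma>" and tm: "wf_tm \<Delta> (\<gamma> ! i) (subst_ty \<gamma> (\<Gamma> ! i))"
    using \<gamma> i by (auto simp: wf_sub_iff)
  show "ivars \<Gamma> ! i \<cdot> (isub (\<Delta>, \<gamma>, \<Gamma>) \<cdot> isub (\<Theta>, \<delta>, \<Delta>)) =
      ivars \<Theta> ! tm_idx (subst_comp \<gamma> \<delta> ! i)"
    using Comp_assoc[OF isub_in[OF \<delta>] isub_in[OF \<gamma>] ivars_nth_in[OF \<Gamma>(1) i]]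
      ivars_nth_isub[OF \<gamma> i] ivars_tm_isub[OF \<delta> tm] i \<Gamma> by simp
qed

lemma isph_subst:
  assumes \<gamma>: "wf_sub \<Delta> \<gamma> \<Gamma>" and A: "wf_ty \<Gamma> A"
  shows "isph \<Delta> (subst_ty \<gamma> A) = isph \<Gamma> A \<cdot> isub (\<Delta>, \<gamma>, \<Gamma>)"
  using sph_of_comp[OF interp_realizes[OF wf_ty_wf_ctx[OF A]] A isub_in[OF \<gamma>]] ivars_isub[OF \<gamma>]
    sph_of_subst[OF A wf_sub_length[OF \<gamma>]] by (simp add: isph_def)

lemma ity_subst:
  assumes \<gamma>: "wf_sub \<Delta> \<gamma> \<Gamma>" and A: "wf_ty \<Gamma> A"
  shows "ity \<Delta> (subst_ty \<gamma> A) = tysub C (isub (\<Delta>, \<gamma>, \<Gamma>)) (ity \<Gamma> A)"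
  using GTy_natural[OF isub_in[OF \<gamma>] isph_in[OF A]] isph_subst[OF assms] by (simp add: ity_def)

lemma isub_proj:
  assumes A: "wf_ty \<Gamma> A"
  shows "isub (\<Gamma> @ [A], subst_id (length \<Gamma>), \<Gamma>) = iproj \<Gamma> A"
proof (rule isub_eqI[OF wf_sub_proj[OF A]])
  have \<Gamma>: "wf_ctx \<Gamma>" using A wf_ty_wf_ctx by blast
  show "iproj \<Gamma> A \<in> hom C (iobj (\<Gamma> @ [A])) (iobj \<Gamma>)"
    using iproj_in[OF interp_realizes[OF \<Gamma>] A] by simp
  show "ivars \<Gamma> ! i \<cdot> iproj \<Gamma> A = ivars (\<Gamma> @ [A]) ! tm_idx (subst_id (length \<Gamma>) ! i)"
    if "i < length \<Gamma>" for i
    using that length_ivars[OF \<Gamma>] by (simp add: nth_append)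
qed

definition itm :: "gctx \<Rightarrow> gty \<Rightarrow> gtm \<Rightarrow> 'e" where
  "itm \<Gamma> A t = disk_term (ty_dim A) (ivars \<Gamma> ! tm_idx t)"

lemma itm_in: "wf_tm \<Gamma> t A \<Longrightarrow> itm \<Gamma> A t \<in> Tm C (iobj \<Gamma>) (ity \<Gamma> A)"
  using disk_term_in[OF ivars_tm(1)] ivars_tm(2) by (simp add: itm_def ity_def)

lemma itm_subst:
  assumes "wf_sub \<Delta> \<gamma> \<Gamma>" "wf_tm \<Gamma> t A"
  shows "itm \<Delta> (subst_ty \<gamma> A) (subst_tm \<gamma> t) = tmsub C (isub (\<Delta>, \<gamma>, \<Gamma>)) (ity \<Gamma> A) (itm \<Gamma> A t)"
  using disk_term_comp[OF ivars_tm(1)[OF assms(2)] isub_in[OF assms(1)]] ivars_tm(2)[OF assms(2)]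
    ivars_tm_isub[OF assms] by (simp add: itm_def ity_def)

text \<open>The newest variable was recorded as the disk map of the generic term, and
  \<open>disk_term\<close> undoes exactly this.\<close>

lemma itm_last:
  assumes A: "wf_ty \<Gamma> A"
  shows "itm (\<Gamma> @ [A]) A (Var (length \<Gamma>)) = Gen C (iobj \<Gamma>) (ity \<Gamma> A)"
proof -
  have \<Gamma>: "wf_ctx \<Gamma>" using A wf_ty_wf_ctx by blast
  note e = ext_interp[OF interp_realizes[OF \<Gamma>] A]
  show ?thesis
    using disk_term_disk_map[OF e(3,5)] length_ivars[OF \<Gamma>]
    by (simp add: itm_def nth_append ilast_def)
qed

text \<open>The values \<open>undefined\<close> outside the carriers are the ones that
  \<open>cwf_morphism\<close> prescribes.\<close>

definition interp :: "(gctx, gmor, gty, gtm, 'o, 'm, 't, 'e) cwf_mor" where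
  "interp = \<lparr>fob = restrict iobj (Obj Syn_Glob), farr = restrict isub (Arr Syn_Glob),
     fty = (\<lambda>\<Gamma> A. if wf_ty \<Gamma> A then ity \<Gamma> A else undefined),
     ftm = (\<lambda>\<Gamma> A t. if wf_tm \<Gamma> t A then itm \<Gamma> A t else undefined)\<rparr>"

lemma interp_simps [simp]:
  "wf_ctx \<Gamma> \<Longrightarrow> fob interp \<Gamma> = iobj \<Gamma>"
  "wf_sub \<Delta> \<gamma> \<Gamma> \<Longrightarrow> farr interp (\<Delta>, \<gamma>, \<Gamma>) = isub (\<Delta>, \<gamma>, \<Gamma>)"
  "wf_ty \<Gamma> A \<Longrightarrow> fty interp \<Gamma> A = ity \<Gamma> A"
  "wf_tm \<Gamma> t A \<Longrightarrow> ftm interp \<Gamma> A t = itm \<Gamma> A t"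
  by (simp_all add: interp_def)

lemma iobj_Obj: "wf_ctx \<Gamma> \<Longrightarrow> iobj \<Gamma> \<in> Obj C"
  using interp_realizes by (simp add: realizes_def)

lemma interp_functor: "is_functor Syn_Glob C interp"
  unfolding is_functor_def
proof (intro conjI ballI impI)
  fix f assume "f \<in> Arr Syn_Glob"
  then obtain \<Delta> \<gamma> \<Gamma> where f: "f = (\<Delta>, \<gamma>, \<Gamma>)" "wf_sub \<Delta> \<gamma> \<Gamma>" by (cases f) auto
  then show "farr interp f \<in> hom C (fob interp (Dom Syn_Glob f)) (fob interp (Cod Syn_Glob f))"
    using isub_in[OF f(2)] by (simp add: wf_sub_iff)
  fix g assume "g \<in> Arr Syn_Glob" "Cod Syn_Glob f = Dom Syn_Glob g"
  then obtain \<delta> \<Theta> where g: "g = (\<Gamma>, \<delta>, \<Theta>)" "wf_sub \<Gamma> \<delta> \<Theta>" using f by (cases g) auto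
  show "farr interp (Comp Syn_Glob g f) = farr interp g \<cdot> farr interp f"
    using f g by (simp add: wf_sub_comp isub_comp)
qed (auto simp: iobj_Obj isub_id wf_sub_id)

lemma interp_cwf_morphism: "cwf_morphism Syn_Glob C interp"
  unfolding cwf_morphism_def
proof (intro conjI ballI allI impI)
  show "fob interp \<in> extensional (Obj Syn_Glob)" "farr interp \<in> extensional (Arr Syn_Glob)"
    by (simp_all add: interp_def)
  show "fty interp \<Gamma> A = undefined" if "\<not> (\<Gamma> \<in> Obj Syn_Glob \<and> A \<in> Ty Syn_Glob \<Gamma>)" for \<Gamma> A
    using that by (auto simp: interp_def intro: wf_ty_wf_ctx)
  show "ftm interp \<Gamma> A a = undefined"
    if "\<not> (\<Gamma> \<in> Obj Syn_Glob \<and> A \<in> Ty Syn_Glob \<Gamma> \<and> a \<in> Tm Syn_Glob \<Gamma> A)" for \<Gamma> A a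
    using that by (auto simp: interp_def intro: wf_ty_wf_ctx wf_tm_wf_ty)
qed (auto elim!: hom_Syn_GlobE simp: interp_functor itm_in ity_in[OF interp_realizes]
    wf_ty_subst wf_tm_subst wf_ty_weaken wf_sub_proj wf_tm_last
    ity_subst itm_subst isub_proj itm_last subst_ty_id)

end

section \<open>The comparison isomorphism\<close>

text \<open>The iterated endpoints of a type, lowest dimension first, are the entries of its
  classifying substitution into a sphere context.\<close>

primrec ty_sub :: "gty \<Rightarrow> gsub" where
  "ty_sub Star = []"
| "ty_sub (Arrow A t u) = ty_sub A @ [t, u]"

lemma length_ty_sub [simp]: "length (ty_sub A) = 2 * ty_dim A"
  by (induction A) auto

lemma subst_ty_sub: "subst_ty (ty_sub A) (U_ty (ty_dim A)) = A"
proof (induction A)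
  case (Arrow A t u)
  then show ?case
    using subst_ty_append[OF wf_U_ty[of "ty_dim A"], of "ty_sub A" "[t, u]"]
    by (simp add: nth_append)
qed simp

lemma wf_ty_sub: "wf_ty \<Gamma> A \<Longrightarrow> wf_sub \<Gamma> (ty_sub A) (sph_ctx (ty_dim A))"
proof (induction A)
  case (Arrow A t u)
  then show ?case
    by (simp add: wf_sub_sph_Suc_iff subst_ty_sub del: sph_ctx_Suc)
qed simp

text \<open>Terms are classified in the same way: appending the term to the boundary of its type
  gives a substitution into a disk context whose last entry is that term.\<close>

lemma wf_tm_sub: "wf_tm \<Gamma> t A \<Longrightarrow> wf_sub \<Gamma> (ty_sub A @ [t]) (disk_ctx (ty_dim A))"
  by (simp add: wf_sub_disk_iff wf_ty_sub[OF wf_tm_wf_ty] subst_ty_sub)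

context globular_cwf
begin

text \<open>The body of the unique existence in \<open>globular_morphism\<close> for source
  \<open>Syn_Glob\<close>, isolated so that existence and uniqueness of \<open>\<alpha>\<close> can
  be treated separately from the morphism.\<close>

definition comparison ::
  "(gctx, gmor, gty, gtm, 'o, 'm, 't, 'e) cwf_mor \<Rightarrow> (nat \<Rightarrow> 'm) \<Rightarrow> bool" where
  "comparison h \<alpha> \<longleftrightarrow>
     natural_iso (opposite Globe) C (ftor_comp h (Disk Syn_Glob)) (Disk C) \<alpha> \<and>
     (\<forall>n. \<forall>\<Gamma> \<in> Obj Syn_Glob. \<forall>\<sigma> \<in> hom Syn_Glob \<Gamma> (Sph Syn_Glob n).
        fty h \<Gamma> (GTy Syn_Glob n \<sigma>) = GTy C n (sph_map Syn_Glob C h \<alpha> n \<cdot> farr h \<sigma>)) \<and>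
     (\<forall>n. let B = fty h (Sph Syn_Glob n) (GTy Syn_Glob n (Ide Syn_Glob (Sph Syn_Glob n))) in
        \<alpha> n \<cdot> farr h (DiskIso Syn_Glob n) =
        DiskIso C n \<cdot>
          ext_map C (S n) (U n)
             (sph_map Syn_Glob C h \<alpha> n \<cdot> Proj C (fob h (Sph Syn_Glob n)) B)
             (Gen C (fob h (Sph Syn_Glob n)) B))"

lemma globular_morphism_iff:
  "globular_morphism Syn_Glob C h \<longleftrightarrow> cwf_morphism Syn_Glob C h \<and> (\<exists>!\<alpha>. comparison h \<alpha>)"
  unfolding globular_morphism_def comparison_def by simp

abbreviation icomp :: "nat \<Rightarrow> 'm" where
  "icomp n \<equiv> ilast (sph_ctx n) (U_ty n)"

lemma ivars_disk: "ivars (disk_ctx n) ! (2 * n) = icomp n"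
  by (simp add: disk_ctx_def nth_append length_ivars)

lemma icomp_in: "icomp n \<in> hom C (iobj (disk_ctx n)) (D n)"
  using ivars_nth_in[of "disk_ctx n" "2 * n"] by (simp add: ivars_disk)

lemma tymap_icomp: "tymap C n \<cdot> icomp n = isph (disk_ctx n) (U_ty n)"
  using ivars_tm(2)[OF wf_tm_last[OF wf_U_ty[of n]]]
  by (simp add: disk_ctx_def[symmetric] ivars_disk)

lemma icomp_isub:
  assumes "wf_sub \<Delta> (\<gamma> @ [t]) (disk_ctx n)"
  shows "icomp n \<cdot> isub (\<Delta>, \<gamma> @ [t], disk_ctx n) = ivars \<Delta> ! tm_idx t"
  using ivars_nth_isub[OF assms, of "2 * n"] wf_sub_length[OF assms]
  by (simp add: ivars_disk nth_append)

lemma isph_eqI: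
  assumes A: "wf_ty \<Gamma> (Arrow A t u)" and v: "v \<in> hom C (iobj \<Gamma>) (S (Suc (ty_dim A)))"
    and "SphL C (ty_dim A) \<cdot> v = ivars \<Gamma> ! tm_idx t" "SphR C (ty_dim A) \<cdot> v = ivars \<Gamma> ! tm_idx u"
  shows "isph \<Gamma> (Arrow A t u) = v"
  using ivars_tm[of \<Gamma> t A] ivars_tm[of \<Gamma> u A] A assms(3,4) isph_in[OF A]
  by (intro sph_eqI[OF _ v]) (auto simp: isph_def SphL_pair SphR_pair)

lemma Sph_isph:
  assumes A: "wf_ty \<Gamma> (Arrow A t u)"
  shows "SphL C (ty_dim A) \<cdot> isph \<Gamma> (Arrow A t u) = ivars \<Gamma> ! tm_idx t"
    "SphR C (ty_dim A) \<cdot> isph \<Gamma> (Arrow A t u) = ivars \<Gamma> ! tm_idx u"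
  using ivars_tm[of \<Gamma> t A] ivars_tm[of \<Gamma> u A] A
  by (auto simp: isph_def SphL_pair SphR_pair)

text \<open>In positive dimension index both maps have the same two pullback components, the
  interpretations of the last two variables of the sphere context; at index \<open>0\<close> both
  are the map into the terminal object.\<close>

lemma sph_map_interp: "sph_map Syn_Glob C interp icomp n = isph (sph_ctx n) (U_ty n)"
proof (cases n)
  case 0
  then show ?thesis by (simp add: isph_def)
next
  case (Suc m)
  have L: "icomp m \<cdot> farr interp (SphL Syn_Glob m) = ivars (sph_ctx n) ! (2 * m)"
    using wf_sub_SphL[of m] icomp_isub[OF wf_sub_SphL[of m]] by (simp add: Suc)
  have R: "icomp m \<cdot> farr interp (SphR Syn_Glob m) = ivars (sph_ctx n) ! (2 * m + 1)"
    using wf_sub_SphR[of m] icomp_isub[OF wf_sub_SphR[of m]] by (simp add: Suc)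
  have U: "wf_ty (sph_ctx n) (U_ty n)" by (rule wf_U_ty)
  have e: "U_ty n = Arrow (U_ty m) (Var (2 * m)) (Var (2 * m + 1))" by (simp add: Suc)
  have "(THE u. u \<in> hom C (iobj (sph_ctx n)) (S (Suc m)) \<and>
      SphL C m \<cdot> u = ivars (sph_ctx n) ! (2 * m) \<and>
      SphR C m \<cdot> u = ivars (sph_ctx n) ! (2 * m + 1)) = isph (sph_ctx n) (U_ty n)"
  proof (rule the_equality, goal_cases)
    case 1
    show ?case using isph_in[OF U] Sph_isph[OF U[unfolded e]] by (simp add: Suc del: sph_ctx_Suc)
  next
    case (2 u)
    then show ?case unfolding e by (intro isph_eqI[OF U[unfolded e], symmetric]) simp_all
  qed
  then show ?thesis using L R by (simp add: Suc del: sph_ctx_Suc Syn_Glob_simps(17,18))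
qed

text \<open>A map into a sphere is a pair of cells with a common boundary. The induction hypothesis
  unfolds that boundary into its lower cells, and the pair is appended. Uniqueness makes the lower
  entries of a disk realization redundant.\<close>

lemma realizes_sphere:
  "s \<in> hom C Y (S n) \<Longrightarrow> \<exists>!ws. realizes Y ws (sph_ctx n) \<and> sph_of Y ws (U_ty n) = s"
proof (induction n arbitrary: s)
  case 0
  then have Y: "Y \<in> Obj C" using hom_Obj by blast
  show ?case using to_S0_unique[OF to_S0[OF Y] 0] Y by (auto simp: realizes_def)
next
  case (Suc n)
  let ?l = "SphL C n \<cdot> s" and ?r = "SphR C n \<cdot> s"
  have l: "?l \<in> hom C Y (D n)" and r: "?r \<in> hom C Y (D n)"
    using Comp_in[OF Suc.prems] SphL_in SphR_in by auto
  have lr: "tymap C n \<cdot> ?l = tymap C n \<cdot> ?r" by (rule tymap_SphL_comp[OF Suc.prems])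
  obtain ws where ws: "realizes Y ws (sph_ctx n)" "sph_of Y ws (U_ty n) = tymap C n \<cdot> ?l"
    and unique: "\<And>vs. \<lbrakk>realizes Y vs (sph_ctx n); sph_of Y vs (U_ty n) = tymap C n \<cdot> ?l\<rbrakk> \<Longrightarrow> vs = ws"
    using Suc.IH[OF Comp_in[OF l tymap_in]] by blast
  have len: "length vs = 2 * n" if "realizes Y vs (sph_ctx n)" for vs
    using realizes_length[OF that] by simp
  \<comment> \<open>The boundary of \<open>y\<close> is computed in a family that already contains
    \<open>x\<close>; \<open>sph_of_append\<close> removes \<open>x\<close>, which makes the two
    cells parallel.\<close>
  have split: "realizes Y (vs @ [x, y]) (sph_ctx (Suc n)) \<longleftrightarrow> realizes Y vs (sph_ctx n) \<and>
      x \<in> hom C Y (D n) \<and> tymap C n \<cdot> x = sph_of Y vs (U_ty n) \<and>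
      y \<in> hom C Y (D n) \<and> tymap C n \<cdot> y = sph_of Y vs (U_ty n)" for vs x y
  proof -
    have "realizes Y ((vs @ [x]) @ [y]) (disk_ctx n @ [U_ty n]) \<longleftrightarrow> realizes Y (vs @ [x]) (disk_ctx n) \<and>
      y \<in> hom C Y (D n) \<and> tymap C n \<cdot> y = sph_of Y (vs @ [x]) (U_ty n)"
      using realizes_snoc[OF wf_U_ty_disk[of n], of Y "vs @ [x]" y] by simp
    moreover have "realizes Y (vs @ [x]) (disk_ctx n) \<longleftrightarrow> realizes Y vs (sph_ctx n) \<and>
      x \<in> hom C Y (D n) \<and> tymap C n \<cdot> x = sph_of Y vs (U_ty n)"
      using realizes_snoc[OF wf_U_ty[of n]] by (simp add: disk_ctx_def)
    ultimately show ?thesis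
      using sph_of_append[OF wf_U_ty[of n], of vs Y "[x]"] len[of vs] by auto
  qed
  have pair_lr: "pair n ?l ?r = s"
    using pair[OF l r lr] by (intro sph_eqI[OF _ Suc.prems]) auto
  show ?case
  proof (rule ex1I[of _ "ws @ [?l, ?r]"])
    show "realizes Y (ws @ [?l, ?r]) (sph_ctx (Suc n)) \<and>
        sph_of Y (ws @ [?l, ?r]) (U_ty (Suc n)) = s"
      unfolding split using ws l r lr len[OF ws(1)] pair_lr by (simp add: nth_append)
  next
    fix vs assume vs: "realizes Y vs (sph_ctx (Suc n)) \<and> sph_of Y vs (U_ty (Suc n)) = s"
    then have "length vs = Suc (Suc (2 * n))" using realizes_length by fastforce
    then obtain vs' x y where v: "vs = vs' @ [x, y]"
      by (cases vs rule: rev_cases; cases "butlast vs" rule: rev_cases) auto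
    note v' = vs[unfolded v split]
    have "pair n x y = s" using v' len[of vs'] by (simp add: nth_append)
    then have "x = ?l" "y = ?r" using SphL_pair[of x Y n y] SphR_pair[of x Y n y] v' by auto
    then show "vs = ws @ [?l, ?r]" using unique[of vs'] v v' by simp
  qed
qed

text \<open>Given \<open>d\<close> into the disk, \<open>realizes_sphere\<close> supplies the only
  lower cells compatible with its boundary, and \<open>interp_universal\<close> turns the completed
  family into the unique factorization of \<open>d\<close> through \<open>icomp n\<close>.\<close>

lemma icomp_iso: "is_iso C (icomp n)"
proof (rule is_isoI_representable[OF icomp_in])
  fix Y d assume d: "d \<in> hom C Y (D n)"
  obtain ws where ws: "realizes Y ws (sph_ctx n)" "sph_of Y ws (U_ty n) = tymap C n \<cdot> d"
    and unique: "\<And>vs. \<lbrakk>realizes Y vs (sph_ctx n); sph_of Y vs (U_ty n) = tymap C n \<cdot> d\<rbrakk> \<Longrightarrow> vs = ws"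
    using realizes_sphere[OF Comp_in[OF d tymap_in]] by blast
  have split: "realizes Y (vs @ [x]) (disk_ctx n) \<longleftrightarrow> realizes Y vs (sph_ctx n) \<and>
      x \<in> hom C Y (D n) \<and> tymap C n \<cdot> x = sph_of Y vs (U_ty n)" for vs x
    using realizes_snoc[OF wf_U_ty[of n]] by (simp add: disk_ctx_def)
  have "realizes Y (ws @ [d]) (disk_ctx n)" using split ws d by simp
  note ex1 = interp_universal[OF wf_disk_ctx this]
  have iv: "ivars (disk_ctx n) = map (\<lambda>v. v \<cdot> iproj (sph_ctx n) (U_ty n)) (ivars (sph_ctx n)) @ [icomp n]"
    by (simp add: disk_ctx_def)
  \<comment> \<open>Prescribing the last entry alone is as strong as prescribing the whole
    family.\<close>
  have "map (\<lambda>v. v \<cdot> u) (ivars (disk_ctx n)) = ws @ [d] \<longleftrightarrow> icomp n \<cdot> u = d"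
    if u: "u \<in> hom C Y (iobj (disk_ctx n))" for u
  proof
    assume "icomp n \<cdot> u = d"
    then obtain vs where vs: "map (\<lambda>v. v \<cdot> u) (ivars (disk_ctx n)) = vs @ [d]"
      unfolding iv by simp
    have "realizes Y (vs @ [d]) (disk_ctx n)"
      using realizes_comp[OF interp_realizes[OF wf_disk_ctx] wf_disk_ctx u] vs by simp
    then show "map (\<lambda>v. v \<cdot> u) (ivars (disk_ctx n)) = ws @ [d]"
      using split unique vs by simp
  qed (simp add: iv)
  then show "\<exists>!u. u \<in> hom C Y (iobj (disk_ctx n)) \<and> icomp n \<cdot> u = d"
    using ex1 by blast
qed

text \<open>The boundary of the top variable is the pair of variables \<open>2 * n\<close> and
  \<open>2 * n + 1\<close>, and \<open>gen_sub n g\<close> ends in one of these according to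
  \<open>g\<close>.\<close>

lemma icomp_natural_gen:
  "bd n g \<cdot> icomp (Suc n) = icomp n \<cdot> isub (disk_ctx (Suc n), gen_sub n g, disk_ctx n)"
proof -
  have U: "wf_ty (disk_ctx (Suc n)) (Arrow (U_ty n) (Var (2 * n)) (Var (2 * n + 1)))"
    using wf_U_ty_disk[of "Suc n"] by simp
  have eqs: "SphL C n \<cdot> (tymap C (Suc n) \<cdot> icomp (Suc n)) = ivars (disk_ctx (Suc n)) ! (2 * n)"
    "SphR C n \<cdot> (tymap C (Suc n) \<cdot> icomp (Suc n)) = ivars (disk_ctx (Suc n)) ! (2 * n + 1)"
    using Sph_isph[OF U] tymap_icomp[of "Suc n"] by simp_all
  show ?thesis
    using eqs Comp_assoc[OF icomp_in tymap_in SphL_in, of n] Comp_assoc[OF icomp_in tymap_in SphR_in, of n]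
      SphL_tymap[of n] SphR_tymap[of n] wf_gen_sub[of n g]
    by (cases g) (simp_all add: icomp_isub)
qed

lemma icomp_natural:
  "farr (Disk C) f \<cdot> icomp (Dom (opposite Globe) f) =
    icomp (Cod (opposite Globe) f) \<cdot> farr (ftor_comp interp (Disk Syn_Glob)) f"
proof (induction f rule: path_induct)
  case (nil i)
  then show ?case
    using Ide_Comp[OF icomp_in[of i]] Comp_Ide[OF icomp_in[of i]] isub_id[of "disk_ctx i"]
      wf_sub_id[of "disk_ctx i"]
    by (simp add: Disk_nil ftor_comp_def)
next
  case (gen i g p)
  let ?k = "Suc i + path_length p"
  let ?q = "isub (disk_ctx ?k, path_sub (Suc i) p, disk_ctx (Suc i))"
  let ?g = "isub (disk_ctx (Suc i), gen_sub i g, disk_ctx i)"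
  have wq: "wf_sub (disk_ctx ?k) (path_sub (Suc i) p) (disk_ctx (Suc i))" by (rule wf_path_sub)
  have IH: "farr (Disk C) (Suc i, p) \<cdot> icomp ?k = icomp (Suc i) \<cdot> ?q"
    using gen wq by (simp add: ftor_comp_def)
  have p: "farr (Disk C) (Suc i, p) \<in> hom C (D ?k) (D (Suc i))" using Disk_in[of "Suc i" p] by simp
  have "farr (Disk C) (i, path_append (path_gen g) p) \<cdot> icomp ?k =
      (bd i g \<cdot> farr (Disk C) (Suc i, p)) \<cdot> icomp ?k"
    by (simp add: Disk_append)
  also have "\<dots> = bd i g \<cdot> (icomp (Suc i) \<cdot> ?q)"
    using Comp_assoc[OF icomp_in p bd_in] IH by simp
  also have "\<dots> = (icomp i \<cdot> ?g) \<cdot> ?q"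
    using Comp_assoc[OF isub_in[OF wq] icomp_in bd_in] icomp_natural_gen by simp
  also have "\<dots> = icomp i \<cdot> (?g \<cdot> ?q)"
    using Comp_assoc[OF isub_in[OF wq] isub_in[OF wf_gen_sub] icomp_in] by simp
  also have "?g \<cdot> ?q = farr (ftor_comp interp (Disk Syn_Glob)) (i, path_append (path_gen g) p)"
    using isub_comp[OF wq wf_gen_sub] wf_sub_comp[OF wq wf_gen_sub[of i g]]
    by (simp add: ftor_comp_def path_sub_append)
  finally show ?case by simp
qed

lemma interp_comparison: "comparison interp icomp"
  unfolding comparison_def
proof (intro conjI allI ballI)
  show "natural_iso (opposite Globe) C (ftor_comp interp (Disk Syn_Glob)) (Disk C) icomp"
    unfolding natural_iso_def using icomp_natural icomp_iso icomp_in
    by (auto simp: ftor_comp_def simp del: opposite_Globe_simps(3,4))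
next
  fix n \<Gamma> \<sigma> assume "\<sigma> \<in> hom Syn_Glob \<Gamma> (Sph Syn_Glob n)"
  then obtain \<gamma> where \<gamma>: "\<sigma> = (\<Gamma>, \<gamma>, sph_ctx n)" "wf_sub \<Gamma> \<gamma> (sph_ctx n)"
    by (auto elim: hom_Syn_GlobE)
  then show "fty interp \<Gamma> (GTy Syn_Glob n \<sigma>) =
      GTy C n (sph_map Syn_Glob C interp icomp n \<cdot> farr interp \<sigma>)"
    using wf_ty_subst[OF wf_U_ty \<gamma>(2)] isph_subst[OF \<gamma>(2) wf_U_ty]
    by (simp add: sph_map_interp ity_def)
next
  fix n
  \<comment> \<open>\<open>DiskIso\<close> of the syntactic category is an identity, so the last
    condition says that \<open>icomp n\<close> is the disk map of the generic term, which is how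
    \<open>ilast\<close> was defined.\<close>
  have "wf_sub (disk_ctx n) (subst_id (Suc (2 * n))) (disk_ctx n)"
    using wf_sub_id[of "disk_ctx n"] by simp
  moreover have "isub (disk_ctx n, subst_id (Suc (2 * n)), disk_ctx n) = Ide C (iobj (disk_ctx n))"
    using isub_id[of "disk_ctx n"] by simp
  ultimately show "let B = fty interp (Sph Syn_Glob n) (GTy Syn_Glob n (Ide Syn_Glob (Sph Syn_Glob n))) in
      icomp n \<cdot> farr interp (DiskIso Syn_Glob n) = DiskIso C n \<cdot> ext_map C (S n) (U n)
        (sph_map Syn_Glob C interp icomp n \<cdot> Proj C (fob interp (Sph Syn_Glob n)) B)
        (Gen C (fob interp (Sph Syn_Glob n)) B)"
    using Comp_Ide[OF icomp_in[of n]] wf_U_ty[of n]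
    by (simp add: Let_def subst_ty_id sph_map_interp ilast_def[of "sph_ctx n"] disk_map_def)
qed

end

section \<open>Uniqueness\<close>

context globular_cwf
begin

text \<open>The map into a sphere of \<open>C\<close> through which an arbitrary morphism sees the
  type \<open>A\<close>; it plays for \<open>h\<close> the role that \<open>isph\<close> plays for
  \<open>interp\<close>.\<close>

definition ty_class ::
  "(gctx, gmor, gty, gtm, 'o, 'm, 't, 'e) cwf_mor \<Rightarrow> (nat \<Rightarrow> 'm) \<Rightarrow> gctx \<Rightarrow> gty \<Rightarrow> 'm" where
  "ty_class h \<alpha> \<Gamma> A =
     sph_map Syn_Glob C h \<alpha> (ty_dim A) \<cdot> farr h (\<Gamma>, ty_sub A, sph_ctx (ty_dim A))"

section \<open>Morphisms out of the syntactic category\<close>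

context
  fixes h :: "(gctx, gmor, gty, gtm, 'o, 'm, 't, 'e) cwf_mor"
  assumes h: "cwf_morphism Syn_Glob C h"
begin

lemma mor_functor: "is_functor Syn_Glob C h"
  using h unfolding cwf_morphism_def by (elim conjE)

lemma mor_obj: "wf_ctx \<Gamma> \<Longrightarrow> fob h \<Gamma> \<in> Obj C"
  using mor_functor by (simp add: is_functor_def)

lemma mor_arr:
  assumes "wf_sub \<Delta> \<gamma> \<Gamma>"
  shows "farr h (\<Delta>, \<gamma>, \<Gamma>) \<in> hom C (fob h \<Delta>) (fob h \<Gamma>)"
proof -
  have "\<forall>f \<in> Arr Syn_Glob. farr h f \<in> hom C (fob h (Dom Syn_Glob f)) (fob h (Cod Syn_Glob f))"
    using mor_functor unfolding is_functor_def by (elim conjE)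
  from this[rule_format, of "(\<Delta>, \<gamma>, \<Gamma>)"] assms show ?thesis by simp
qed

lemma mor_ide: "wf_ctx \<Gamma> \<Longrightarrow> farr h (\<Gamma>, subst_id (length \<Gamma>), \<Gamma>) = Ide C (fob h \<Gamma>)"
  using mor_functor by (simp add: is_functor_def)

lemma mor_comp: "\<lbrakk>wf_sub \<Theta> \<delta> \<Delta>; wf_sub \<Delta> \<gamma> \<Gamma>\<rbrakk>
    \<Longrightarrow> farr h (\<Theta>, subst_comp \<gamma> \<delta>, \<Gamma>) = farr h (\<Delta>, \<gamma>, \<Gamma>) \<cdot> farr h (\<Theta>, \<delta>, \<Delta>)"
proof -
  assume a: "wf_sub \<Theta> \<delta> \<Delta>" "wf_sub \<Delta> \<gamma> \<Gamma>"
  have "\<forall>f \<in> Arr Syn_Glob. \<forall>g \<in> Arr Syn_Glob. Cod Syn_Glob f = Dom Syn_Glob g \<longrightarrow>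
        farr h (Comp Syn_Glob g f) = farr h g \<cdot> farr h f"
    using mor_functor unfolding is_functor_def by (elim conjE)
  from this[rule_format, of "(\<Theta>, \<delta>, \<Delta>)" "(\<Delta>, \<gamma>, \<Gamma>)"] a show ?thesis by simp
qed

lemma mor_ty: "wf_ty \<Gamma> A \<Longrightarrow> fty h \<Gamma> A \<in> Ty C (fob h \<Gamma>)"
  using h wf_ty_wf_ctx unfolding cwf_morphism_def by simp

lemma mor_tysub:
  assumes "wf_sub \<Delta> \<gamma> \<Gamma>" "wf_ty \<Gamma> A"
  shows "fty h \<Delta> (subst_ty \<gamma> A) = tysub C (farr h (\<Delta>, \<gamma>, \<Gamma>)) (fty h \<Gamma> A)"
proof -
  have "\<forall>\<Delta> \<in> Obj Syn_Glob. \<forall>\<Gamma> \<in> Obj Syn_Glob. \<forall>\<sigma> \<in> hom Syn_Glob \<Delta> \<Gamma>. \<forall>A \<in> Ty Syn_Glob \<Gamma>.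
        fty h \<Delta> (tysub Syn_Glob \<sigma> A) = tysub C (farr h \<sigma>) (fty h \<Gamma> A)"
    using h unfolding cwf_morphism_def by (elim conjE)
  from this[rule_format, of \<Delta> \<Gamma> "(\<Delta>, \<gamma>, \<Gamma>)" A] assms show ?thesis by (simp add: wf_sub_iff)
qed

lemma mor_tmsub:
  assumes "wf_sub \<Delta> \<gamma> \<Gamma>" "wf_tm \<Gamma> t A"
  shows "ftm h \<Delta> (subst_ty \<gamma> A) (subst_tm \<gamma> t) =
    tmsub C (farr h (\<Delta>, \<gamma>, \<Gamma>)) (fty h \<Gamma> A) (ftm h \<Gamma> A t)"
proof -
  have "\<forall>\<Delta> \<in> Obj Syn_Glob. \<forall>\<Gamma> \<in> Obj Syn_Glob. \<forall>\<sigma> \<in> hom Syn_Glob \<Delta> \<Gamma>. \<forall>A \<in> Ty Syn_Glob \<Gamma>.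
        \<forall>a \<in> Tm Syn_Glob \<Gamma> A. ftm h \<Delta> (tysub Syn_Glob \<sigma> A) (tmsub Syn_Glob \<sigma> A a) =
        tmsub C (farr h \<sigma>) (fty h \<Gamma> A) (ftm h \<Gamma> A a)"
    using h unfolding cwf_morphism_def by (elim conjE)
  from this[rule_format, of \<Delta> \<Gamma> "(\<Delta>, \<gamma>, \<Gamma>)" A t] assms show ?thesis
    by (simp add: wf_sub_iff wf_tm_wf_ty)
qed

lemma mor_empty: "fob h [] = One C"
  using h unfolding cwf_morphism_def by simp

lemma mor_snoc:
  assumes "wf_ty \<Gamma> A"
  shows "fob h (\<Gamma> @ [A]) = Ext C (fob h \<Gamma>) (fty h \<Gamma> A)"
    "farr h (\<Gamma> @ [A], subst_id (length \<Gamma>), \<Gamma>) = Proj C (fob h \<Gamma>) (fty h \<Gamma> A)"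
    "ftm h (\<Gamma> @ [A]) A (Var (length \<Gamma>)) = Gen C (fob h \<Gamma>) (fty h \<Gamma> A)"
  using h assms wf_ty_wf_ctx[OF assms] unfolding cwf_morphism_def by (simp_all add: subst_ty_id)

lemma mor_undefined:
  "\<not> wf_ctx \<Gamma> \<Longrightarrow> fob h \<Gamma> = undefined"
  "\<not> wf_sub \<Delta> \<gamma> \<Gamma> \<Longrightarrow> farr h (\<Delta>, \<gamma>, \<Gamma>) = undefined"
  "\<not> wf_ty \<Gamma> A \<Longrightarrow> fty h \<Gamma> A = undefined"
  "\<not> wf_tm \<Gamma> t A \<Longrightarrow> ftm h \<Gamma> A t = undefined"
  using h unfolding cwf_morphism_def by (simp_all add: extensional_def)

section \<open>Morphisms equipped with a comparison\<close>

context
  fixes \<alpha> :: "nat \<Rightarrow> 'm"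
  assumes \<alpha>: "comparison h \<alpha>"
begin

abbreviation sph :: "nat \<Rightarrow> 'm" where
  "sph n \<equiv> sph_map Syn_Glob C h \<alpha> n"

lemma comparison_in: "\<alpha> n \<in> hom C (fob h (disk_ctx n)) (D n)"
  using \<alpha> unfolding comparison_def natural_iso_def by (auto simp: ftor_comp_def)

lemma fty_U_subst:
  assumes "wf_sub \<Gamma> \<gamma> (sph_ctx n)"
  shows "fty h \<Gamma> (subst_ty \<gamma> (U_ty n)) = GTy C n (sph n \<cdot> farr h (\<Gamma>, \<gamma>, sph_ctx n))"
proof -
  have "\<forall>n. \<forall>\<Gamma> \<in> Obj Syn_Glob. \<forall>\<sigma> \<in> hom Syn_Glob \<Gamma> (Sph Syn_Glob n).
        fty h \<Gamma> (GTy Syn_Glob n \<sigma>) = GTy C n (sph n \<cdot> farr h \<sigma>)"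
    using \<alpha> unfolding comparison_def by (elim conjE)
  from this[rule_format, of \<Gamma> "(\<Gamma>, \<gamma>, sph_ctx n)" n] assms show ?thesis by (simp add: wf_sub_iff)
qed

text \<open>Here and up to \<open>sph_Suc\<close> the typing of \<open>sph n\<close> is a
  hypothesis, since \<open>sph_in\<close> obtains it by an induction whose step consists of these
  facts.\<close>

lemma fty_U:
  assumes "sph n \<in> hom C (fob h (sph_ctx n)) (S n)"
  shows "fty h (sph_ctx n) (U_ty n) = GTy C n (sph n)"
  using fty_U_subst[OF wf_sub_id[OF wf_sph_ctx], of n] Comp_Ide[OF assms] mor_ide[OF wf_sph_ctx[of n]]
  by (simp add: subst_ty_id[OF wf_U_ty])

text \<open>As the syntactic \<open>DiskIso\<close> is an identity, the coherence condition becomes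
  an explicit formula for \<open>\<alpha> n\<close> in terms of \<open>sph n\<close>. This formula
  is what makes \<open>\<alpha>\<close> unique.\<close>

lemma comparison_eq:
  "\<alpha> n = disk_map n (sph n \<cdot> Proj C (fob h (sph_ctx n)) (fty h (sph_ctx n) (U_ty n)))
     (Gen C (fob h (sph_ctx n)) (fty h (sph_ctx n) (U_ty n)))"
proof -
  have "farr h (DiskIso Syn_Glob n) = Ide C (fob h (disk_ctx n))"
    using mor_ide[OF wf_disk_ctx[of n]] by simp
  then have "\<alpha> n \<cdot> farr h (DiskIso Syn_Glob n) = \<alpha> n"
    using Comp_Ide[OF comparison_in] by simp
  moreover have "\<forall>n. let B = fty h (Sph Syn_Glob n) (GTy Syn_Glob n (Ide Syn_Glob (Sph Syn_Glob n))) in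
        \<alpha> n \<cdot> farr h (DiskIso Syn_Glob n) =
        DiskIso C n \<cdot>
          ext_map C (S n) (U n) (sph n \<cdot> Proj C (fob h (Sph Syn_Glob n)) B)
             (Gen C (fob h (Sph Syn_Glob n)) B)"
    using \<alpha> unfolding comparison_def by (elim conjE)
  ultimately show ?thesis
    by (simp add: Let_def subst_ty_id[OF wf_U_ty] disk_map_def del: Syn_Glob_simps(20))
qed

lemma mor_proj_U:
  "farr h (disk_ctx n, subst_id (2 * n), sph_ctx n) =
     Proj C (fob h (sph_ctx n)) (fty h (sph_ctx n) (U_ty n))"
  using mor_snoc(2)[OF wf_U_ty[of n]] by (simp add: disk_ctx_def)

lemma mor_proj_U_in:
  "Proj C (fob h (sph_ctx n)) (fty h (sph_ctx n) (U_ty n)) \<in> hom C (fob h (disk_ctx n)) (fob h (sph_ctx n))"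
  using Proj_in[OF mor_obj[OF wf_sph_ctx] mor_ty[OF wf_U_ty]] mor_snoc(1)[OF wf_U_ty]
  by (simp add: disk_ctx_def)

lemma mor_Gen_U_in:
  assumes s: "sph n \<in> hom C (fob h (sph_ctx n)) (S n)"
  shows "Gen C (fob h (sph_ctx n)) (fty h (sph_ctx n) (U_ty n)) \<in>
    Tm C (fob h (disk_ctx n))
      (GTy C n (sph n \<cdot> Proj C (fob h (sph_ctx n)) (fty h (sph_ctx n) (U_ty n))))"
  using Gen_in[OF mor_obj[OF wf_sph_ctx] mor_ty[OF wf_U_ty[of n]]] mor_snoc(1)[OF wf_U_ty[of n]]
    GTy_natural[OF mor_proj_U_in s] fty_U[OF s]
  by (simp add: disk_ctx_def)

lemma tymap_comparison:
  assumes s: "sph n \<in> hom C (fob h (sph_ctx n)) (S n)"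
  shows "tymap C n \<cdot> \<alpha> n = sph n \<cdot> farr h (disk_ctx n, subst_id (2 * n), sph_ctx n)"
  using tymap_disk_map[OF Comp_in[OF mor_proj_U_in s] mor_Gen_U_in[OF s]] comparison_eq[of n]
  by (simp add: mor_proj_U)

text \<open>\<open>SphL\<close> and \<open>SphR\<close> agree after projection to
  \<open>sph_ctx n\<close>, so by \<open>tymap_comparison\<close> their images under
  \<open>h\<close>, followed by \<open>\<alpha> n\<close>, have equal boundary and induce a map into
  the pullback.\<close>

lemma sph_Suc:
  assumes s: "sph n \<in> hom C (fob h (sph_ctx n)) (S n)"
  shows "sph (Suc n) \<in> hom C (fob h (sph_ctx (Suc n))) (S (Suc n)) \<and>
    SphL C n \<cdot> sph (Suc n) = \<alpha> n \<cdot> farr h (SphL Syn_Glob n) \<and>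
    SphR C n \<cdot> sph (Suc n) = \<alpha> n \<cdot> farr h (SphR Syn_Glob n)"
proof -
  have L: "farr h (SphL Syn_Glob n) \<in> hom C (fob h (sph_ctx (Suc n))) (fob h (disk_ctx n))"
    using mor_arr[OF wf_sub_SphL] by simp
  have R: "farr h (SphR Syn_Glob n) \<in> hom C (fob h (sph_ctx (Suc n))) (fob h (disk_ctx n))"
    using mor_arr[OF wf_sub_SphR] by simp
  let ?p = "farr h (disk_ctx n, subst_id (2 * n), sph_ctx n)"
  have wp: "wf_sub (disk_ctx n) (subst_id (2 * n)) (sph_ctx n)"
    using wf_sub_proj[OF wf_U_ty[of n]] by (simp add: disk_ctx_def)
  note p = mor_arr[OF wp]
  have "?p \<cdot> farr h (SphL Syn_Glob n) = ?p \<cdot> farr h (SphR Syn_Glob n)"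
    using mor_comp[OF wf_sub_SphL wp] mor_comp[OF wf_sub_SphR wp] by (simp add: subst_comp_id_take)
  then have "tymap C n \<cdot> (\<alpha> n \<cdot> farr h (SphL Syn_Glob n)) = tymap C n \<cdot> (\<alpha> n \<cdot> farr h (SphR Syn_Glob n))"
    using Comp_assoc[OF L comparison_in tymap_in] Comp_assoc[OF R comparison_in tymap_in]
      Comp_assoc[OF L p s] Comp_assoc[OF R p s] tymap_comparison[OF s] by simp
  from theI'[OF pullback_ex1[OF tymap_in Comp_in[OF L comparison_in] Comp_in[OF R comparison_in] this]]
  show ?thesis by simp
qed

lemma sph_in: "sph n \<in> hom C (fob h (sph_ctx n)) (S n)"
proof (induction n)
  case 0
  show ?case using to_S0[OF mor_obj[of "[]"]] by simp
next
  case (Suc n)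
  then show ?case using sph_Suc by blast
qed

lemma ty_class_in: "wf_ty \<Gamma> A \<Longrightarrow> ty_class h \<alpha> \<Gamma> A \<in> hom C (fob h \<Gamma>) (S (ty_dim A))"
  unfolding ty_class_def by (rule Comp_in[OF mor_arr[OF wf_ty_sub] sph_in])

lemma fty_ty_class: "wf_ty \<Gamma> A \<Longrightarrow> fty h \<Gamma> A = GTy C (ty_dim A) (ty_class h \<alpha> \<Gamma> A)"
  using fty_U_subst[OF wf_ty_sub] by (simp add: ty_class_def subst_ty_sub)

text \<open>A term is the last variable of a disk context pulled back along its classifying
  substitution. Since \<open>h\<close> preserves that generic term and \<open>comparison_eq\<close>
  describes \<open>\<alpha>\<close> on it, the value of \<open>h\<close> on any term can be read
  off.\<close>

lemma comparison_tm_sub: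
  assumes t: "wf_tm \<Gamma> t A"
  shows "\<alpha> (ty_dim A) \<cdot> farr h (\<Gamma>, ty_sub A @ [t], disk_ctx (ty_dim A)) =
    disk_map (ty_dim A) (ty_class h \<alpha> \<Gamma> A) (ftm h \<Gamma> A t)"
proof -
  let ?n = "ty_dim A"
  let ?X = "fob h (sph_ctx ?n)" and ?B = "fty h (sph_ctx ?n) (U_ty ?n)"
  let ?w = "farr h (\<Gamma>, ty_sub A @ [t], disk_ctx ?n)"
  note w = mor_arr[OF wf_tm_sub[OF t]]
  have wp: "wf_sub (disk_ctx ?n) (subst_id (2 * ?n)) (sph_ctx ?n)"
    using wf_sub_proj[OF wf_U_ty[of ?n]] by (simp add: disk_ctx_def)
  have "Proj C ?X ?B \<cdot> ?w = farr h (\<Gamma>, ty_sub A, sph_ctx ?n)"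
    using mor_comp[OF wf_tm_sub[OF t] wp] mor_proj_U by (simp add: subst_comp_id_take)
  then have s: "(sph ?n \<cdot> Proj C ?X ?B) \<cdot> ?w = ty_class h \<alpha> \<Gamma> A"
    using Comp_assoc[OF w mor_proj_U_in sph_in] by (simp add: ty_class_def)
  have last: "wf_tm (disk_ctx ?n) (Var (2 * ?n)) (U_ty ?n)"
    using wf_tm_last[OF wf_U_ty[of ?n]] by (simp add: disk_ctx_def)
  have "GTy C ?n (sph ?n \<cdot> Proj C ?X ?B) = fty h (disk_ctx ?n) (U_ty ?n)"
    using fty_U_subst[OF wp] mor_proj_U by (simp add: subst_ty_id[OF wf_U_ty])
  moreover have "Gen C ?X ?B = ftm h (disk_ctx ?n) (U_ty ?n) (Var (2 * ?n))"
    using mor_snoc(3)[OF wf_U_ty[of ?n]] by (simp add: disk_ctx_def)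
  moreover have "subst_ty (ty_sub A @ [t]) (U_ty ?n) = A"
    using subst_ty_append[OF wf_U_ty[of ?n], of "ty_sub A" "[t]"] by (simp add: subst_ty_sub)
  ultimately have "tmsub C ?w (GTy C ?n (sph ?n \<cdot> Proj C ?X ?B)) (Gen C ?X ?B) = ftm h \<Gamma> A t"
    using mor_tmsub[OF wf_tm_sub[OF t] last] by (simp add: nth_append)
  then show ?thesis
    using disk_map_comp[OF Comp_in[OF mor_proj_U_in sph_in] mor_Gen_U_in[OF sph_in] w]
      comparison_eq[of ?n] s by simp
qed

text \<open>Expresses the class of an arrow type through data of lower dimension, which permits the
  induction on types in \<open>ty_class_cong\<close>.\<close>

lemma ty_class_Arrow:
  assumes A: "wf_ty \<Gamma> (Arrow A t u)"
  shows "ty_class h \<alpha> \<Gamma> (Arrow A t u) = pair (ty_dim A) (disk_map (ty_dim A) (ty_class h \<alpha> \<Gamma> A) (ftm h \<Gamma> A t))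
    (disk_map (ty_dim A) (ty_class h \<alpha> \<Gamma> A) (ftm h \<Gamma> A u))"
proof -
  let ?n = "ty_dim A"
  have tm: "wf_tm \<Gamma> t A" "wf_tm \<Gamma> u A" and A': "wf_ty \<Gamma> A" using A by auto
  let ?w = "farr h (\<Gamma>, ty_sub A @ [t, u], sph_ctx (Suc ?n))"
  have ws: "wf_sub \<Gamma> (ty_sub A @ [t, u]) (sph_ctx (Suc ?n))" using wf_ty_sub[OF A] by simp
  note w = mor_arr[OF ws]
  have LR: "farr h (SphL Syn_Glob ?n) \<in> hom C (fob h (sph_ctx (Suc ?n))) (fob h (disk_ctx ?n))"
     "farr h (SphR Syn_Glob ?n) \<in> hom C (fob h (sph_ctx (Suc ?n))) (fob h (disk_ctx ?n))"
    using mor_arr[OF wf_sub_SphL] mor_arr[OF wf_sub_SphR] by simp_all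
  have hLR: "farr h (SphL Syn_Glob ?n) \<cdot> ?w = farr h (\<Gamma>, ty_sub A @ [t], disk_ctx ?n)"
    "farr h (SphR Syn_Glob ?n) \<cdot> ?w = farr h (\<Gamma>, ty_sub A @ [u], disk_ctx ?n)"
    using mor_comp[OF ws wf_sub_SphL] mor_comp[OF ws wf_sub_SphR]
    by (simp_all add: subst_comp_id_take nth_append)
  note s = sph_Suc[OF sph_in, of ?n]
  have c: "ty_class h \<alpha> \<Gamma> (Arrow A t u) = sph (Suc ?n) \<cdot> ?w"
    by (simp add: ty_class_def del: sph_ctx_Suc sph_map.simps)
  have L: "SphL C ?n \<cdot> ty_class h \<alpha> \<Gamma> (Arrow A t u) = disk_map ?n (ty_class h \<alpha> \<Gamma> A) (ftm h \<Gamma> A t)"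
    unfolding c comparison_tm_sub[OF tm(1), symmetric] hLR[symmetric]
    using Comp_assoc[OF w sph_in SphL_in] Comp_assoc[OF w LR(1) comparison_in] s by simp
  have R: "SphR C ?n \<cdot> ty_class h \<alpha> \<Gamma> (Arrow A t u) = disk_map ?n (ty_class h \<alpha> \<Gamma> A) (ftm h \<Gamma> A u)"
    unfolding c comparison_tm_sub[OF tm(2), symmetric] hLR[symmetric]
    using Comp_assoc[OF w sph_in SphR_in] Comp_assoc[OF w LR(2) comparison_in] s by simp
  have v: "ty_class h \<alpha> \<Gamma> (Arrow A t u) \<in> hom C (fob h \<Gamma>) (S (Suc ?n))" using ty_class_in[OF A] by simp
  note p = pair[OF Comp_in[OF v SphL_in] Comp_in[OF v SphR_in] tymap_SphL_comp[OF v]]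
  show ?thesis unfolding L[symmetric] R[symmetric]
    by (rule sph_eqI[OF v p(1)]) (simp_all only: p)
qed

end

section \<open>Uniqueness of the comparison and of the morphism\<close>

lemma comparison_unique:
  assumes "comparison h \<alpha>" "comparison h \<beta>"
  shows "\<alpha> = \<beta>"
proof
  fix n
  have "sph_map Syn_Glob C h \<alpha> n = sph_map Syn_Glob C h \<beta> n \<and> \<alpha> n = \<beta> n"
  \<comment> \<open>The sphere comparison at \<open>0\<close> does not involve the comparison map
    and at \<open>Suc n\<close> involves only its value at \<open>n\<close>;
    \<open>comparison_eq\<close> supplies that value.\<close>
  proof (induction n)
    case 0
    then show ?case using comparison_eq[OF assms(1), of 0] comparison_eq[OF assms(2), of 0] by simp
  next
    case (Suc n)
    then have "sph_map Syn_Glob C h \<alpha> (Suc n) = sph_map Syn_Glob C h \<beta> (Suc n)" by simp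
    then show ?case
      using comparison_eq[OF assms(1), of "Suc n"] comparison_eq[OF assms(2), of "Suc n"] by metis
  qed
  then show "\<alpha> n = \<beta> n" ..
qed

end

lemma ty_class_cong:
  assumes h: "cwf_morphism Syn_Glob C h" "comparison h \<alpha>"
    and k: "cwf_morphism Syn_Glob C k" "comparison k \<beta>"
    and ob: "fob h \<Gamma> = fob k \<Gamma>" and tm: "\<And>t A. wf_tm \<Gamma> t A \<Longrightarrow> ftm h \<Gamma> A t = ftm k \<Gamma> A t"
    and A: "wf_ty \<Gamma> A"
  shows "ty_class h \<alpha> \<Gamma> A = ty_class k \<beta> \<Gamma> A"
  using A
proof (induction A rule: gty.induct)
  case Star
  then show ?case using ty_class_in[OF h Star] ty_class_in[OF k Star] ob to_S0_unique by simp
next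
  case (Arrow A t u)
  then show ?case
    using ty_class_Arrow[OF h Arrow.prems] ty_class_Arrow[OF k Arrow.prems] tm by simp
qed

text \<open>Objects and terms are settled first, by induction on contexts, and types follow from
  them. Substitutions come last: their images are maps into comprehensions, hence determined by a
  shorter substitution and a term.\<close>

lemma comparison_morphism_unique:
  assumes h: "cwf_morphism Syn_Glob C h" "comparison h \<alpha>"
    and k: "cwf_morphism Syn_Glob C k" "comparison k \<beta>"
  shows "h = k"
proof -
  have ty_cong: "fty h \<Gamma> A = fty k \<Gamma> A"
    if "fob h \<Gamma> = fob k \<Gamma>" "\<forall>t A. wf_tm \<Gamma> t A \<longrightarrow> ftm h \<Gamma> A t = ftm k \<Gamma> A t" "wf_ty \<Gamma> A" for \<Gamma> A
    using ty_class_cong[OF h k that(1) _ that(3)] that fty_ty_class[OF h that(3)] fty_ty_class[OF k that(3)] by simp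
  \<comment> \<open>Objects and terms go together: the image of an extended context depends on the
    image of the new type, which depends on the images of terms in the shorter context.\<close>
  have agree: "fob h \<Gamma> = fob k \<Gamma> \<and> (\<forall>t A. wf_tm \<Gamma> t A \<longrightarrow> ftm h \<Gamma> A t = ftm k \<Gamma> A t)"
    if "wf_ctx \<Gamma>" for \<Gamma>
    using that
  proof (induction \<Gamma> rule: rev_induct)
    case Nil
    show ?case using mor_empty[OF h(1)] mor_empty[OF k(1)] by (simp add: wf_tm_iff)
  next
    case (snoc B \<Gamma>)
    then have B: "wf_ty \<Gamma> B" and \<Gamma>: "wf_ctx \<Gamma>" by (auto dest: wf_ty_wf_ctx)
    note IH = snoc.IH[OF \<Gamma>]
    note tB = ty_cong[OF IH[THEN conjunct1] IH[THEN conjunct2] B]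
    have "ftm h (\<Gamma> @ [B]) A t = ftm k (\<Gamma> @ [B]) A t" if t: "wf_tm (\<Gamma> @ [B]) t A" for t A
    proof -
      obtain i where i: "i < length (\<Gamma> @ [B])" "t = Var i" "A = (\<Gamma> @ [B]) ! i"
        using t by (auto simp: wf_tm_iff)
      show ?thesis
      proof (cases "i < length \<Gamma>")
        case True
        then have A: "wf_tm \<Gamma> t A" using i \<Gamma> by (auto simp: nth_append wf_tm_iff)
        note wA = wf_tm_wf_ty[OF A]
        \<comment> \<open>An older variable is its own weakening along the projection, so
          preservation of term substitution reduces it to the shorter context.\<close>
        have "subst_tm (subst_id (length \<Gamma>)) t = t" "subst_ty (subst_id (length \<Gamma>)) A = A"
          using subst_tm_id[OF A] subst_ty_id[OF wA] by auto
        then show ?thesis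
          using mor_tmsub[OF h(1) wf_sub_proj[OF B] A] mor_tmsub[OF k(1) wf_sub_proj[OF B] A]
            mor_snoc(2)[OF h(1) B] mor_snoc(2)[OF k(1) B] tB IH A
            ty_cong[OF IH[THEN conjunct1] IH[THEN conjunct2] wA] by simp
      next
        case False
        then have "t = Var (length \<Gamma>)" "A = B" using i by (auto simp: nth_append)
        then show ?thesis
          using mor_snoc(3)[OF h(1) B] mor_snoc(3)[OF k(1) B] tB IH by simp
      qed
    qed
    then show ?case using mor_snoc(1)[OF h(1) B] mor_snoc(1)[OF k(1) B] tB IH by simp
  qed
  \<comment> \<open>Outside the carriers both morphisms are \<open>undefined\<close>, so agreement
    extends to all arguments and gives equality of records.\<close>
  have ob: "fob h \<Gamma> = fob k \<Gamma>" for \<Gamma>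
    using agree mor_undefined(1)[OF h(1)] mor_undefined(1)[OF k(1)] by metis
  have tm: "ftm h \<Gamma> A t = ftm k \<Gamma> A t" for \<Gamma> A t
    using agree mor_undefined(4)[OF h(1)] mor_undefined(4)[OF k(1)] wf_tm_iff by metis
  have ty: "fty h \<Gamma> A = fty k \<Gamma> A" for \<Gamma> A
    using ty_cong ob tm mor_undefined(3)[OF h(1)] mor_undefined(3)[OF k(1)] by metis
  have arr: "farr h (\<Delta>, \<gamma>, \<Gamma>) = farr k (\<Delta>, \<gamma>, \<Gamma>)" if "wf_sub \<Delta> \<gamma> \<Gamma>" for \<Delta> \<gamma> \<Gamma>
    using that
  proof (induction rule: wf_sub.induct)
    case (sub_empty \<Delta>)
    then have e: "wf_sub \<Delta> [] []" by simp
    show ?case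
      using mor_arr[OF h(1) e] mor_arr[OF k(1) e] ob mor_empty[OF k(1)] to_One_unique by simp
  next
    case (sub_ext \<Delta> \<gamma> \<Gamma> A t)
    have A: "wf_ty \<Gamma> A" and s: "wf_sub \<Delta> (\<gamma> @ [t]) (\<Gamma> @ [A])"
      using sub_ext by (auto simp: wf_sub_snoc)
    have l: "length \<gamma> = length \<Gamma>" using sub_ext wf_sub_length by blast
    have \<Gamma>: "wf_ctx \<Gamma>" using A wf_ty_wf_ctx by blast
    let ?X = "fob k \<Gamma>" and ?T = "fty k \<Gamma> A"
    have c: "subst_comp (subst_id (length \<Gamma>)) (\<gamma> @ [t]) = \<gamma>" using l by (simp add: subst_comp_id_take)
    have ph: "Proj C ?X ?T \<cdot> farr h (\<Delta>, \<gamma> @ [t], \<Gamma> @ [A]) = farr h (\<Delta>, \<gamma>, \<Gamma>)"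
      using mor_comp[OF h(1) s wf_sub_proj[OF A]] mor_snoc(2)[OF h(1) A] c ob ty by simp
    have pk: "Proj C ?X ?T \<cdot> farr k (\<Delta>, \<gamma> @ [t], \<Gamma> @ [A]) = farr k (\<Delta>, \<gamma>, \<Gamma>)"
      using mor_comp[OF k(1) s wf_sub_proj[OF A]] mor_snoc(2)[OF k(1) A] c by simp
    have pT: "tysub C (Proj C ?X ?T) ?T = fty k (\<Gamma> @ [A]) A"
      using mor_tysub[OF k(1) wf_sub_proj[OF A] A] mor_snoc(2)[OF k(1) A] subst_ty_id[OF A] by simp
    have tm_eq: "tmsub C (farr h (\<Delta>, \<gamma> @ [t], \<Gamma> @ [A])) (tysub C (Proj C ?X ?T) ?T) (Gen C ?X ?T) =
      tmsub C (farr k (\<Delta>, \<gamma> @ [t], \<Gamma> @ [A])) (tysub C (Proj C ?X ?T) ?T) (Gen C ?X ?T)"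
      unfolding pT mor_snoc(3)[OF k(1) A, symmetric]
      using mor_tmsub[OF h(1) s wf_tm_last[OF A]] mor_tmsub[OF k(1) s wf_tm_last[OF A]] tm ty by simp
    have fh: "farr h (\<Delta>, \<gamma> @ [t], \<Gamma> @ [A]) \<in> hom C (fob k \<Delta>) (Ext C ?X ?T)"
      using mor_arr[OF h(1) s] unfolding ob mor_snoc(1)[OF k(1) A] .
    have fk: "farr k (\<Delta>, \<gamma> @ [t], \<Gamma> @ [A]) \<in> hom C (fob k \<Delta>) (Ext C ?X ?T)"
      using mor_arr[OF k(1) s] unfolding mor_snoc(1)[OF k(1) A] .
    have pr: "Proj C ?X ?T \<cdot> farr h (\<Delta>, \<gamma> @ [t], \<Gamma> @ [A]) =
        Proj C ?X ?T \<cdot> farr k (\<Delta>, \<gamma> @ [t], \<Gamma> @ [A])"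
      unfolding ph pk by (rule sub_ext.IH)
    show ?case
      by (rule Ext_eqI[OF mor_ty[OF k(1) A] mor_obj[OF k(1) \<Gamma>] fh fk pr tm_eq])
  qed
  have arr': "farr h f = farr k f" for f
    using arr mor_undefined(2)[OF h(1)] mor_undefined(2)[OF k(1)] by (cases f) metis
  show ?thesis
  proof (rule cwf_mor.equality)
  qed (use ob tm ty arr' in \<open>auto intro!: ext\<close>)
qed

lemma ex1_globular_morphism: "\<exists>!h. globular_morphism Syn_Glob C h"
proof (rule ex1I)
  show "globular_morphism Syn_Glob C interp"
    unfolding globular_morphism_iff
    using interp_cwf_morphism interp_comparison comparison_unique[OF interp_cwf_morphism] by blast
  show "h = interp" if "globular_morphism Syn_Glob C h" for h
    using that comparison_morphism_unique[OF _ _ interp_cwf_morphism interp_comparison]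
    unfolding globular_morphism_iff by blast
qed

end

theorem theorem2p22:
  shows "globular_cwf Syn_Glob \<and>
    (\<forall>D :: ('o, 'm, 't, 'e) gcwf. globular_cwf D \<longrightarrow> (\<exists>!h. globular_morphism Syn_Glob D h))"
  using globular_cwf_Syn_Glob globular_cwf.ex1_globular_morphism by blast

end
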